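(* With $n=\dim$, $$\mathrm{vol}\left(\mathbb{R}^{n-1}/R(\mathbb{Z})^+\right)=\begin{cases}\frac{\sqrt{|\mathrm{disc}(R(\mathbb{Z}))|}}{2}&\text{if }\dim=3,\\[2pt] \frac{\sqrt{|\mathrm{disc}(R(\mathbb{Z}))|}}{2\sqrt{|\iota(\mathrm{disc}(\ddagger))|}}&\text{if }\dim=4,\\[2pt] \frac{\sqrt{|\mathrm{disc}(R(\mathbb{Z}))|}}{4}&\text{if }\dim=5.\end{cases}$$
   Context: Fix $\dim\in\{3,4,5\}$. If $\dim=3$, $R(\mathbb{Z})$ is the ring of integers of an imaginary quadratic field; if $\dim=4$, $R(\mathbb{Z})$ is a maximal $\ddagger$-order (order stable under $\ddagger$, maximal among such) of a rational definite quaternion algebra $H=\left(\frac{a,b}{\mathbb{Q}}\right)$ ($i^2=a<0$, $j^2=b<0$, $ij=-ji$) with orthogonal involution $(x+yi+zj+tij)^\ddagger=x+yi+zj-tij$; if $\dim=5$, a maximal order of a rational definite quaternion algebra. $\bar\cdot$ is the standard conjugation, $\mathrm{tr}(\alpha)=\alpha+\bar\alpha$, $\mathrm{nrm}(\alpha)=\alpha\bar\alpha$. $R(\mathbb{Z})^+$ is the $\ddagger$-fixed subset if $\dim=4$ and $R(\mathbb{Z})$ otherwise; it is a lattice in $R(\mathbb{Z})^+\otimes\mathbb{R}\cong\mathbb{R}^{\dim-1}$ with the Euclidean inner product $\mathrm{tr}(x\bar y)/2$, and vol denotes its covolume. $\mathrm{disc}(R(\mathbb{Z}))$ is the ideal of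 $\mathbb{Z}$ generated by $\det(\mathrm{tr}(e_k\overline{e_l}))$ for a $\mathbb{Z}$-basis $(e_k)$ of $R(\mathbb{Z})$. $\mathrm{disc}(\ddagger)=\alpha^2(\mathbb{Q}^\times)^2$ for any nonzero $\alpha\in H$ with $\alpha^\ddagger=-\alpha$, and $\iota(\mathrm{disc}(\ddagger))$ is the ideal of $\mathbb{Z}$ generated by $\mathrm{disc}(\ddagger)\cap\mathbb{Z}$. For an ideal $I$ of $\mathbb{Z}$, $|I|$ is its smallest non-negative generator. *)

theory Defs
  imports "HOL-Analysis.Analysis" "HOL-Algebra.IntRing"
begin

section \<open>Covolume and integral bases\<close>

definition fundamental_domain :: "'a::euclidean_space set \<Rightarrow> 'a set \<Rightarrow> bool" where
  "fundamental_domain L F \<longleftrightarrow> F \<in> sets lborel \<and> (\<forall>x. \<exists>!l. l \<in> L \<and> x - l \<in> F)"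

text \<open>The volume of the quotient of the ambient space by L: the common Lebesgue measure of
  all measurable fundamental domains.\<close>

definition covolume :: "'a::euclidean_space set \<Rightarrow> real" where
  "covolume L = (THE v. \<exists>F. fundamental_domain L F \<and> v = measure lborel F)"

text \<open>The action s of the ground field is explicit because it is the ring multiplication for
  complex numbers, but the coordinatewise scaling \<open>(*s)\<close> for rational quaternions.\<close>

definition is_Zbasis ::
  "('k::ring_1 \<Rightarrow> 'v \<Rightarrow> 'v) \<Rightarrow> 'v::ab_group_add ^ 'n \<Rightarrow> 'v set \<Rightarrow> bool" where
  "is_Zbasis s e L \<longleftrightarrow>
     bij_betw (\<lambda>c::int^'n. \<Sum>k\<in>UNIV. s (of_int (c $ k)) (e $ k)) UNIV L"

definition ideal_abs :: "int set \<Rightarrow> nat" where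
  "ideal_abs I = (LEAST m. I = Idl\<^bsub>\<Z>\<^esub> {int m})"


section \<open>Imaginary quadratic fields\<close>

text \<open>Imaginary quadratic fields are taken inside the complex numbers; their standard
  conjugation is then \<^const>\<open>cnj\<close>.\<close>

definition imaginary_quadratic_field :: "complex set \<Rightarrow> bool" where
  "imaginary_quadratic_field K \<longleftrightarrow>
     1 \<in> K \<and> (\<forall>x\<in>K. \<forall>y\<in>K. x - y \<in> K \<and> x * y \<in> K) \<and> (\<forall>x\<in>K. inverse x \<in> K) \<and>
     vector_space.dim (\<lambda>(q::rat) (z::complex). of_rat q * z) K = 2 \<and>
     \<not> K \<subseteq> \<real>"

definition ring_of_integers :: "complex set \<Rightarrow> complex set" where
  "ring_of_integers K = {z \<in> K. algebraic_int z}"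

definition ctr :: "complex \<Rightarrow> complex" where
  "ctr z = z + cnj z"

text \<open>Generating by the determinants of all bases avoids choosing one; any two of them agree.\<close>

definition quad_disc :: "complex set \<Rightarrow> int set" where
  "quad_disc R = Idl\<^bsub>\<Z>\<^esub> {m. \<exists>e::complex^2. is_Zbasis (*) e R \<and>
     of_int m = det (\<chi> k l. ctr (e $ k * cnj (e $ l)))}"

definition embed2 :: "complex \<Rightarrow> real^2" where
  "embed2 z = vector [Re z, Im z]"

lemma embed2_isometry:
  "complex_of_real (embed2 x \<bullet> embed2 y) = ctr (x * cnj y) / 2"
  by (simp add: embed2_def ctr_def inner_vec_def sum_2 complex_eq_iff)


section \<open>Rational quaternion algebras\<close>

text \<open>The vector \<open>(x, y, z, t)\<close> stands for \<open>x + y i + z j + t ij\<close> in the algebra with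
  \<open>i\<^sup>2 = a\<close>, \<open>j\<^sup>2 = b\<close>, \<open>ij = -ji\<close>. Its product is \<open>qmult a b\<close>; the library's \<open>*\<close> on vectors is
  coordinatewise and plays no role here.\<close>

definition quat :: "'a \<Rightarrow> 'a \<Rightarrow> 'a \<Rightarrow> 'a \<Rightarrow> 'a^4" where
  "quat x y z t = (\<chi> k. if k = 1 then x else if k = 2 then y else if k = 3 then z else t)"

lemma quat_nth [simp]:
  "quat x y z t $ 1 = x" "quat x y z t $ 2 = y" "quat x y z t $ 3 = z" "quat x y z t $ 4 = t"
  by (simp_all add: quat_def)

definition qmult :: "rat \<Rightarrow> rat \<Rightarrow> rat^4 \<Rightarrow> rat^4 \<Rightarrow> rat^4" where
  "qmult a b u v = quat
     (u$1 * v$1 + a * u$2 * v$2 + b * u$3 * v$3 - a * b * u$4 * v$4)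
     (u$1 * v$2 + u$2 * v$1 - b * u$3 * v$4 + b * u$4 * v$3)
     (u$1 * v$3 + u$3 * v$1 + a * u$2 * v$4 - a * u$4 * v$2)
     (u$1 * v$4 + u$4 * v$1 + u$2 * v$3 - u$3 * v$2)"

abbreviation qscalar :: "rat \<Rightarrow> rat^4" where
  "qscalar r \<equiv> quat r 0 0 0"

definition qconj :: "rat^4 \<Rightarrow> rat^4" where
  "qconj u = quat (u$1) (- u$2) (- u$3) (- u$4)"

definition ddagger :: "rat^4 \<Rightarrow> rat^4" where
  "ddagger u = quat (u$1) (u$2) (u$3) (- u$4)"

text \<open>The trace is read off as the rational number whose scalar quaternion is \<open>u + qconj u\<close>.\<close>

definition qtr :: "rat^4 \<Rightarrow> rat" where
  "qtr u = (u + qconj u) $ 1"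

lemma qtr_scalar: "u + qconj u = qscalar (qtr u)"
  by (simp add: qtr_def qconj_def vec_eq_iff forall_4)

lemma qmult_presentation:
  "qmult a b (quat 0 1 0 0) (quat 0 1 0 0) = qscalar a"
  "qmult a b (quat 0 0 1 0) (quat 0 0 1 0) = qscalar b"
  "qmult a b (quat 0 1 0 0) (quat 0 0 1 0) = quat 0 0 0 1"
  "qmult a b (quat 0 0 1 0) (quat 0 1 0 0) = - quat 0 0 0 1"
  by (simp_all add: qmult_def vec_eq_iff forall_4)

lemma qmult_assoc: "qmult a b (qmult a b u v) w = qmult a b u (qmult a b v w)"
  by (simp add: qmult_def vec_eq_iff forall_4 algebra_simps)

lemma qmult_one: "qmult a b (qscalar 1) u = u" "qmult a b u (qscalar 1) = u"
  by (simp_all add: qmult_def vec_eq_iff forall_4)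

lemma qconj_qmult: "qconj (qmult a b u v) = qmult a b (qconj v) (qconj u)"
  by (simp add: qmult_def qconj_def vec_eq_iff forall_4 algebra_simps)

lemma ddagger_qmult: "ddagger (qmult a b u v) = qmult a b (ddagger v) (ddagger u)"
  by (simp add: qmult_def ddagger_def vec_eq_iff forall_4 algebra_simps)


subsection \<open>Orders\<close>

definition is_full_lattice :: "(rat^4) set \<Rightarrow> bool" where
  "is_full_lattice L \<longleftrightarrow>
     (\<exists>B. finite B \<and> L = {\<Sum>v\<in>B. of_int (c v) *s v | c :: rat^4 \<Rightarrow> int. True}) \<and>
     vec.span L = UNIV"

definition is_order :: "rat \<Rightarrow> rat \<Rightarrow> (rat^4) set \<Rightarrow> bool" where
  "is_order a b R \<longleftrightarrow>
     is_full_lattice R \<and> qscalar 1 \<in> R \<and> (\<forall>u\<in>R. \<forall>v\<in>R. qmult a b u v \<in> R)"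

definition maximal_order :: "rat \<Rightarrow> rat \<Rightarrow> (rat^4) set \<Rightarrow> bool" where
  "maximal_order a b R \<longleftrightarrow>
     is_order a b R \<and> (\<forall>S. is_order a b S \<and> R \<subseteq> S \<longrightarrow> S = R)"

definition ddagger_order :: "rat \<Rightarrow> rat \<Rightarrow> (rat^4) set \<Rightarrow> bool" where
  "ddagger_order a b R \<longleftrightarrow> is_order a b R \<and> ddagger ` R = R"

definition maximal_ddagger_order :: "rat \<Rightarrow> rat \<Rightarrow> (rat^4) set \<Rightarrow> bool" where
  "maximal_ddagger_order a b R \<longleftrightarrow>
     ddagger_order a b R \<and> (\<forall>S. ddagger_order a b S \<and> R \<subseteq> S \<longrightarrow> S = R)"

definition ddagger_fixed :: "(rat^4) set \<Rightarrow> (rat^4) set" where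
  "ddagger_fixed R = {u \<in> R. ddagger u = u}"


subsection \<open>Discriminants\<close>

definition quat_disc :: "rat \<Rightarrow> rat \<Rightarrow> (rat^4) set \<Rightarrow> int set" where
  "quat_disc a b R = Idl\<^bsub>\<Z>\<^esub> {m. \<exists>e::rat^4^4. is_Zbasis (*s) e R \<and>
     of_int m = det (\<chi> k l. qtr (qmult a b (e $ k) (qconj (e $ l))))}"

text \<open>The square class of \<open>\<alpha>\<^sup>2\<close>, with \<open>\<alpha>\<^sup>2\<close> read as the rational number \<open>r\<close>; the class does
  not depend on \<open>\<alpha>\<close>, so the union over all admissible \<open>\<alpha>\<close> is a single class.\<close>

definition disc_ddagger :: "rat \<Rightarrow> rat \<Rightarrow> rat set" where
  "disc_ddagger a b = {r * q\<^sup>2 | r q. q \<noteq> 0 \<and>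
     (\<exists>\<alpha>. \<alpha> \<noteq> 0 \<and> ddagger \<alpha> = - \<alpha> \<and> qmult a b \<alpha> \<alpha> = qscalar r)}"

definition iota :: "rat set \<Rightarrow> int set" where
  "iota D = Idl\<^bsub>\<Z>\<^esub> {m. of_int m \<in> D}"


subsection \<open>Euclidean structure\<close>

text \<open>For negative \<open>a\<close> and \<open>b\<close> these are the isometric coordinates on the real span of the
  algebra, and of its \<open>ddagger\<close>-fixed part, for the inner product \<open>tr (u \<cdot> conj v) / 2\<close>.\<close>

definition embed4 :: "rat \<Rightarrow> rat \<Rightarrow> rat^4 \<Rightarrow> real^4" where
  "embed4 a b u = quat (of_rat (u$1)) (sqrt (of_rat (- a)) * of_rat (u$2))
     (sqrt (of_rat (- b)) * of_rat (u$3)) (sqrt (of_rat (a * b)) * of_rat (u$4))"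

definition embed3 :: "rat \<Rightarrow> rat \<Rightarrow> rat^4 \<Rightarrow> real^3" where
  "embed3 a b u = vector [of_rat (u$1), sqrt (of_rat (- a)) * of_rat (u$2),
     sqrt (of_rat (- b)) * of_rat (u$3)]"

lemma sqrt_mult_swap: "0 \<le> r \<Longrightarrow> (sqrt r * x) * (sqrt r * y) = r * (x * y)"
  by (simp add: mult.assoc mult.left_commute[of x] flip: mult.assoc[of "sqrt r" "sqrt r"])

lemma embed4_isometry:
  assumes "a < 0" "b < 0"
  shows "embed4 a b u \<bullet> embed4 a b v = of_rat (qtr (qmult a b u (qconj v)) / 2)"
proof -
  have "of_rat (- a) \<ge> (0::real)" "of_rat (- b) \<ge> (0::real)" "of_rat (a * b) \<ge> (0::real)"
    using assms by (simp_all only: zero_le_of_rat_iff) (simp_all add: mult_nonpos_nonpos)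
  then have "embed4 a b u \<bullet> embed4 a b v = of_rat (u$1) * of_rat (v$1)
      + of_rat (- a) * (of_rat (u$2) * of_rat (v$2)) + of_rat (- b) * (of_rat (u$3) * of_rat (v$3))
      + of_rat (a * b) * (of_rat (u$4) * of_rat (v$4))"
    by (simp only: embed4_def inner_vec_def sum_4 inner_real_def quat_nth sqrt_mult_swap)
  moreover have "qtr (qmult a b u (qconj v)) / 2
      = u$1 * v$1 + (- a) * (u$2 * v$2) + (- b) * (u$3 * v$3) + (a * b) * (u$4 * v$4)"
    by (simp add: qtr_def qmult_def qconj_def field_simps)
  ultimately show ?thesis
    by (simp only: of_rat_add of_rat_mult)
qed

lemma embed3_isometry:
  assumes "a < 0" "b < 0" "ddagger u = u" "ddagger v = v"
  shows "embed3 a b u \<bullet> embed3 a b v = of_rat (qtr (qmult a b u (qconj v)) / 2)"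
proof -
  have "u $ 4 = 0" "v $ 4 = 0"
    using assms(3,4) by (auto simp: ddagger_def vec_eq_iff forall_4)
  then have "embed3 a b u \<bullet> embed3 a b v = embed4 a b u \<bullet> embed4 a b v"
    by (simp add: embed3_def embed4_def inner_vec_def sum_3 sum_4)
  then show ?thesis
    using embed4_isometry[OF assms(1,2)] by simp
qed

end

theory Submission
  imports Defs
begin

text \<open>All three formulas compare a covolume with a Gram determinant.  For a \<open>\<int>\<close>-basis of a lattice the
  half-open parallelepiped is a fundamental domain, so the covolume squared is the Gram determinant
  of the basis; as the trace form is twice the inner product, its determinant is \<open>2\<^sup>n\<close> times that.
  Bases exist because the squared determinants of tuples of lattice vectors are discrete: a
  nondegenerate tuple of least determinant generates.

  In dimension 4, write \<open>ab \<cdot> t\<^sup>2 = d\<close> with \<open>d\<close> the least positive integer of this form, and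
  \<open>\<beta> = t ij\<close>, so that \<open>|\<iota>(disc \<ddagger>)| = d\<close> and \<open>\<beta>\<^sup>2 = -d\<close>.  A maximal \<open>\<ddagger>\<close>-order \<open>R\<close> contains \<open>\<beta>\<close>, and
  it contains an element whose \<open>ij\<close>-coordinate is \<open>t / 2\<close>, since otherwise it could be enlarged at
  the prime 2.  Such an element completes a basis of the fixed lattice to one of \<open>R\<close>, and its distance
  from the span of the fixed lattice is \<open>\<surd>d / 2\<close>.\<close>

section \<open>Covolumes and bases of lattices\<close>

text \<open>The obstacle is the prime 2 in dimension 4. Integrality of norms only places the fourth
  coordinates of \<open>R\<close> in (t/2)Z; that t/2 occurs needs maximality. Suppose that all of
  them lie in tZ. Multiplication by \<open>\<beta>\<close> moves first coordinates into fourth ones,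
  so all traces are even. Hence commutators, and squares of elements of even norm, lie in 2R. Choose
  \<open>w\<close> of even norm outside 2R whose product with every element of even norm lies in 2R.
  If 4 divides the norm of \<open>w\<close>, then w/2 is integral and R + Z w/2 is a larger order
  stable under \<open>ddagger\<close>. If not, the norm is 2u with u odd, and multiplying by the
  conjugate of \<open>w\<close> shows that every element of even norm is 0 or \<open>w\<close>
  modulo 2R; then R/2R has at most 4 elements, although the rank is 4. All of this takes place in
  \<open>R\<close> itself, without localisation. The constant 1/2 of dimension 4 is 2 times the 1/4
  that belongs to \<open>R\<close>, the 2 coming from the height of the added basis vector.\<close>

lemma fundamental_domain_emeasure_eq:
  fixes L :: "'a::euclidean_space set"
  assumes L: "countable L" "\<And>l. l \<in> L \<Longrightarrow> - l \<in> L"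
    and F: "fundamental_domain L F" and G: "fundamental_domain L G"
  shows "emeasure lborel F = emeasure lborel G"
proof -
  have Fs: "F \<in> sets borel" and Gs: "G \<in> sets borel"
    using F G by (auto simp: fundamental_domain_def)
  have Fu: "\<exists>!l. l \<in> L \<and> x - l \<in> F" and Gu: "\<exists>!l. l \<in> L \<and> x - l \<in> G" for x
    using F G by (auto simp: fundamental_domain_def)
  \<comment> \<open>\<open>F\<close> is cut along the translates of \<open>G\<close>, and
    \<open>G\<close> along those of \<open>F\<close>. The piece \<open>P l\<close> is
    \<open>Q l\<close> shifted by \<open>l\<close>, so translation invariance matches the pieces one
    by one.\<close>
  define P where "P l = F \<inter> (\<lambda>x. x - l) -` G" for l
  define Q where "Q l = G \<inter> (\<lambda>x. x + l) -` F" for l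
  have meas: "(\<lambda>x. x - l) -` S \<in> sets borel" "(\<lambda>x. x + l) -` S \<in> sets borel"
    if "S \<in> sets borel" for l and S :: "'a set"
    using measurable_sets[of "\<lambda>x. x - l" borel borel S] measurable_sets[of "\<lambda>x. x + l" borel borel S] that
    by auto
  have Ps: "P l \<in> sets borel" and Qs: "Q l \<in> sets borel" for l
    unfolding P_def Q_def using meas Fs Gs by blast+
  have "F = (\<Union>l\<in>L. P l)"
    unfolding P_def using Gu by fastforce
  moreover have "disjoint_family_on P L"
    unfolding disjoint_family_on_def P_def using Gu by fastforce
  ultimately have 1: "emeasure lborel F = (\<integral>\<^sup>+l. emeasure lborel (P l) \<partial>count_space L)"
    using emeasure_UN_countable[of L P lborel] L(1) Ps by auto
  have "G \<subseteq> (\<Union>l\<in>L. Q l)"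
  proof
    fix y assume "y \<in> G"
    obtain l where "l \<in> L" "y - l \<in> F" using Fu by blast
    then show "y \<in> (\<Union>l\<in>L. Q l)"
      unfolding Q_def using L(2)[of l] \<open>y \<in> G\<close> by (auto intro!: bexI[of _ "- l"])
  qed
  then have "G = (\<Union>l\<in>L. Q l)"
    by (auto simp: Q_def)
  moreover have "disjoint_family_on Q L"
    unfolding disjoint_family_on_def
  proof (intro ballI impI)
    fix l k assume *: "l \<in> L" "k \<in> L" "l \<noteq> k"
    have False if "y + l \<in> F" "y + k \<in> F" for y
    proof -
      have "- l \<in> L \<and> y - - l \<in> F" "- k \<in> L \<and> y - - k \<in> F" using that * L(2) by auto
      then have "- l = - k" using Fu[of y] by blast
      then show False using *(3) by simp
    qed
    then show "Q l \<inter> Q k = {}" unfolding Q_def by blast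
  qed
  ultimately have 2: "emeasure lborel G = (\<integral>\<^sup>+l. emeasure lborel (Q l) \<partial>count_space L)"
    using emeasure_UN_countable[of L Q lborel] L(1) Qs by auto
  have "emeasure lborel (P l) = emeasure lborel (Q l)" for l
  proof -
    have "emeasure lborel (P l) = emeasure (distr lborel borel ((+) l)) (P l)"
      by (simp add: lborel_distr_plus)
    also have "\<dots> = emeasure lborel ((+) l -` P l)"
      using Ps by (subst emeasure_distr) auto
    also have "(+) l -` P l = Q l"
      by (auto simp: P_def Q_def add.commute)
    finally show ?thesis .
  qed
  with 1 2 show ?thesis by simp
qed

lemma covolume_eqI:
  fixes L :: "'a::euclidean_space set"
  assumes "countable L" "\<And>l. l \<in> L \<Longrightarrow> - l \<in> L" "fundamental_domain L F"
  shows "covolume L = measure lborel F"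
  unfolding covolume_def
proof (rule the_equality)
  show "\<exists>G. fundamental_domain L G \<and> measure lborel F = measure lborel G"
    using assms(3) by blast
next
  fix v assume "\<exists>G. fundamental_domain L G \<and> v = measure lborel G"
  then obtain G where G: "fundamental_domain L G" "v = measure lborel G" by blast
  show "v = measure lborel F"
    using fundamental_domain_emeasure_eq[OF assms(1,2) G(1) assms(3)] G(2)
    by (simp only: measure_def)
qed

lemma measure_half_open_cube:
  "{c::real^'n. \<forall>k. 0 \<le> c $ k \<and> c $ k < 1} \<in> sets borel" (is "?C \<in> _")
  "measure lebesgue {c::real^'n. \<forall>k. 0 \<le> c $ k \<and> c $ k < 1} = 1"
  "{c::real^'n. \<forall>k. 0 \<le> c $ k \<and> c $ k < 1} \<in> lmeasurable"
proof -
  have "?C = (\<Inter>k\<in>UNIV. {c. 0 \<le> c $ k} \<inter> {c. c $ k < 1})" by auto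
  also have "\<dots> \<in> sets borel"
  proof (rule sets.finite_INT)
    fix k :: 'n
    have "{c::real^'n. 0 \<le> c $ k} \<in> sets borel"
      by (intro borel_closed closed_Collect_le continuous_intros)
    moreover have "{c::real^'n. c $ k < 1} \<in> sets borel"
      by (intro borel_open open_Collect_less continuous_intros)
    ultimately show "{c::real^'n. 0 \<le> c $ k} \<inter> {c. c $ k < 1} \<in> sets borel" by (rule sets.Int)
  qed auto
  finally show C: "?C \<in> sets borel" .
  \<comment> \<open>The half-open cube lies between the open and the closed one, both of measure
    1.\<close>
  have s: "box 0 1 \<subseteq> ?C" "?C \<subseteq> cbox 0 (1::real^'n)"
    by (auto simp: box_def cbox_def Basis_vec_def inner_axis less_imp_le)
  have m: "measure lborel (box 0 (1::real^'n)) = 1" "measure lborel (cbox 0 (1::real^'n)) = 1"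
    by (subst measure_lborel_box measure_lborel_cbox; auto simp: Basis_vec_def inner_axis intro!: prod.neutral)+
  have fm: "cbox 0 (1::real^'n) \<in> fmeasurable lborel" "box 0 (1::real^'n) \<in> fmeasurable lborel"
    by (auto intro: fmeasurableI simp: emeasure_lborel_box_finite emeasure_lborel_cbox_finite)
  have fC: "?C \<in> fmeasurable lborel"
    using fmeasurableI2[OF fm(1) s(2)] C by simp
  have "measure lborel ?C = 1"
  proof (rule antisym)
    show "measure lborel ?C \<le> 1"
      using measure_mono_fmeasurable[OF s(2) _ fm(1)] C m(2) by simp
    show "1 \<le> measure lborel ?C"
      using measure_mono_fmeasurable[OF s(1) _ fC] m(1) by simp
  qed
  then show "measure lebesgue ?C = 1" using C by simp
  show "?C \<in> lmeasurable" using fC C by (simp add: fmeasurable_def)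
qed

text \<open>The linear map with matrix \<open>transpose e\<close> carries the half-open unit cube to
  the fundamental parallelepiped and scales measure by the determinant. The sort
  \<open>wellorder\<close> on the index type comes from \<open>measure_linear_image\<close>.\<close>

lemma covolume_Zbasis:
  fixes e :: "real^'n::{finite,wellorder}^'n::_"
  assumes e: "is_Zbasis (*\<^sub>R) e L" and d: "det e \<noteq> 0"
  shows "covolume L = \<bar>det e\<bar>"
proof -
  define f where "f c = transpose e *v c" for c :: "real^'n::_"
  obtain M where M: "transpose e ** M = mat 1" "M ** transpose e = mat 1"
    using d invertible_det_nz[of "transpose e"] by (auto simp: det_transpose invertible_def)
  define g where "g x = M *v x" for x
  have fg: "f (g x) = x" and gf: "g (f x) = x" for x
    using M by (simp_all add: f_def g_def matrix_vector_mul_assoc del: transpose_matrix_vector)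
  have f_sum: "f c = (\<Sum>k\<in>UNIV. (c $ k) *\<^sub>R (e $ k))" for c
    by (simp add: f_def vec_eq_iff matrix_vector_mult_def transpose_def sum_component mult.commute)
  have lf: "linear f" unfolding f_def by (rule matrix_vector_mul_linear)
  define fl where "fl c = f (\<chi> k. of_int (c $ k))" for c :: "int^'n::_"
  have bij: "bij_betw fl UNIV L"
    using e unfolding is_Zbasis_def fl_def f_sum by simp
  then have L: "L = range fl" by (auto simp: bij_betw_def)
  have cL: "countable L" unfolding L by simp
  have nL: "- l \<in> L" if "l \<in> L" for l
  proof -
    from that obtain c where "l = fl c" unfolding L by auto
    then have "- l = fl (- c)"
      by (simp add: fl_def f_sum scaleR_left.minus sum_negf)
    then show ?thesis unfolding L by auto
  qed
  let ?C = "{c::real^'n::_. \<forall>k. 0 \<le> c $ k \<and> c $ k < 1}"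
  have im: "f ` ?C = g -` ?C"
    using fg gf by (auto simp: image_iff) (metis)
  have "continuous_on UNIV g" unfolding g_def
    by (intro linear_continuous_on linear_linear[THEN iffD2] matrix_vector_mul_linear)
  then have "g \<in> borel_measurable borel" by (rule borel_measurable_continuous_onI)
  then have sF: "f ` ?C \<in> sets borel"
    unfolding im using measurable_sets[of g borel borel ?C] measure_half_open_cube(1) by simp
  have fd: "fundamental_domain L (f ` ?C)"
    unfolding fundamental_domain_def
  proof (intro conjI allI)
    show "f ` ?C \<in> sets lborel" using sF by simp
    fix x
    \<comment> \<open>In basis coordinates, the only lattice vector that moves \<open>x\<close> into
      the cube is the floor of every coordinate: existence and uniqueness at once.\<close>
    have *: "x - fl c \<in> f ` ?C \<longleftrightarrow> c = (\<chi> k. \<lfloor>g x $ k\<rfloor>)" for c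
    proof -
      have "g (x - fl c) = g x - (\<chi> k. of_int (c $ k))"
        using gf by (simp add: g_def fl_def matrix_vector_mult_diff_distrib)
      then have "x - fl c \<in> f ` ?C \<longleftrightarrow> (\<forall>k. 0 \<le> g x $ k - of_int (c $ k) \<and> g x $ k - of_int (c $ k) < 1)"
        unfolding im by simp
      also have "\<dots> \<longleftrightarrow> (\<forall>k. c $ k = \<lfloor>g x $ k\<rfloor>)"
      proof (rule all_cong1)
        fix k show "(0 \<le> g x $ k - of_int (c $ k) \<and> g x $ k - of_int (c $ k) < 1) \<longleftrightarrow> c $ k = \<lfloor>g x $ k\<rfloor>"
          by linarith
      qed
      finally show ?thesis by (simp add: vec_eq_iff)
    qed
    show "\<exists>!l. l \<in> L \<and> x - l \<in> f ` ?C"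
    proof (rule ex1I[of _ "fl (\<chi> k. \<lfloor>g x $ k\<rfloor>)"])
      show "fl (\<chi> k. \<lfloor>g x $ k\<rfloor>) \<in> L \<and> x - fl (\<chi> k. \<lfloor>g x $ k\<rfloor>) \<in> f ` ?C"
        using * L by blast
      fix l assume l: "l \<in> L \<and> x - l \<in> f ` ?C"
      then obtain c where "l = fl c" unfolding L by blast
      then show "l = fl (\<chi> k. \<lfloor>g x $ k\<rfloor>)" using l *[of c] by simp
    qed
  qed
  have "covolume L = measure lborel (f ` ?C)"
    by (rule covolume_eqI[OF cL nL fd])
  also have "\<dots> = measure lebesgue (f ` ?C)"
    using sF by simp
  also have "\<dots> = \<bar>det (matrix f)\<bar> * measure lebesgue ?C"
    by (rule measure_linear_image[OF lf measure_half_open_cube(3)])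
  also have "\<dots> = \<bar>det e\<bar>"
    by (simp add: measure_half_open_cube f_def[abs_def] matrix_of_matrix_vector_mul det_transpose del: transpose_matrix_vector)
  finally show ?thesis .
qed

text \<open>The factor \<open>C\<close> makes squared determinants integral, so that a least nonzero
  one exists. In use it is 2 to the power of the dimension, which yields the Gram determinant of the
  trace form.\<close>

lemma Zbasis_exists:
  fixes L :: "(real^'n) set"
  assumes diff: "\<And>x y. x \<in> L \<Longrightarrow> y \<in> L \<Longrightarrow> x - y \<in> L"
    and disc: "\<And>b::real^'n^'n. \<forall>k. b $ k \<in> L \<Longrightarrow> C * (det b)\<^sup>2 \<in> \<int>" and C: "C > 0"
    and full: "\<forall>k. b0 $ k \<in> L" "det b0 \<noteq> 0"
  obtains e where "is_Zbasis (*\<^sub>R) e L" "det e \<noteq> 0"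
proof -
  define P where "P b \<longleftrightarrow> (\<forall>k. b $ k \<in> L) \<and> det b \<noteq> 0" for b :: "real^'n^'n"
  define \<mu> where "\<mu> b = nat \<lfloor>C * (det b)\<^sup>2\<rfloor>" for b :: "real^'n^'n"
  have \<mu>: "real (\<mu> b) = C * (det b)\<^sup>2" if "P b" for b
    using disc[of b] that C by (auto simp: \<mu>_def P_def Ints_def)
  obtain e where e: "P e" and min: "\<And>b. P b \<Longrightarrow> \<mu> e \<le> \<mu> b"
    using full exists_least_iff[of "\<lambda>m. \<exists>b. P b \<and> \<mu> b = m"]
    by (metis P_def not_less)
  have eL: "e $ k \<in> L" and de: "det e \<noteq> 0" for k using e by (auto simp: P_def)
  have zero: "0 \<in> L" using diff[OF eL eL, of undefined undefined] by simp
  have uminus: "- x \<in> L" if "x \<in> L" for x using diff[OF zero that] by simp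
  have add: "x + y \<in> L" if "x \<in> L" "y \<in> L" for x y using diff[OF that(1) uminus[OF that(2)]] by simp
  have nat: "of_nat m *\<^sub>R x \<in> L" if "x \<in> L" for m x
    by (induction m) (auto simp: zero algebra_simps intro: add that)
  have int: "of_int m *\<^sub>R x \<in> L" if "x \<in> L" for m x
    using nat[OF that] uminus by (cases m rule: int_cases2) auto
  have sum: "(\<Sum>k\<in>S. of_int (c k) *\<^sub>R e $ k) \<in> L" for c and S :: "'n set"
    by (induction S rule: infinite_finite_induct) (auto simp: zero intro: add int eL)
  obtain M where M: "transpose e ** M = mat 1" "M ** transpose e = mat 1"
    using de invertible_det_nz[of "transpose e"] by (auto simp: det_transpose invertible_def)
  define g where "g x = M *v x" for x
  have f_sum: "transpose e *v c = (\<Sum>k\<in>UNIV. (c $ k) *\<^sub>R (e $ k))" for c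
    by (simp add: vec_eq_iff matrix_vector_mult_def transpose_def sum_component mult.commute)
  have fg: "(\<Sum>k\<in>UNIV. (g x $ k) *\<^sub>R (e $ k)) = x" for x
    using M by (simp add: g_def matrix_vector_mul_assoc del: transpose_matrix_vector flip: f_sum)
  have gf: "g (\<Sum>k\<in>UNIV. (c $ k) *\<^sub>R (e $ k)) = c" for c
    using M by (simp add: g_def matrix_vector_mul_assoc del: transpose_matrix_vector flip: f_sum)
  have "is_Zbasis (*\<^sub>R) e L"
    unfolding is_Zbasis_def bij_betw_def
  proof (intro conjI inj_onI subset_antisym subsetI)
    fix c c' :: "int^'n"
    assume "(\<Sum>k\<in>UNIV. of_int (c $ k) *\<^sub>R e $ k) = (\<Sum>k\<in>UNIV. of_int (c' $ k) *\<^sub>R e $ k)"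
    then have "(\<chi> k. of_int (c $ k)) = ((\<chi> k. of_int (c' $ k)) :: real^'n)"
      using gf[of "\<chi> k. of_int (c $ k)"] gf[of "\<chi> k. of_int (c' $ k)"] by simp
    then show "c = c'" by (simp add: vec_eq_iff)
  next
    fix x assume "x \<in> range (\<lambda>c::int^'n. \<Sum>k\<in>UNIV. of_int (c $ k) *\<^sub>R e $ k)"
    then show "x \<in> L" using sum by auto
  next
    fix x assume x: "x \<in> L"
    have frac: "frac (g x $ k) = 0" for k
    proof (rule ccontr)
      assume nz: "frac (g x $ k) \<noteq> 0"
      \<comment> \<open>Replacing \<open>e $ k\<close> by the fractional part of \<open>x\<close>
        multiplies the determinant by a number strictly between 0 and 1, against minimality.\<close>
      define r where "r = (\<chi> j. frac (g x $ j))"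
      define y where "y = (\<Sum>j\<in>UNIV. r $ j *\<^sub>R e $ j)"
      have "y = x - (\<Sum>j\<in>UNIV. of_int \<lfloor>g x $ j\<rfloor> *\<^sub>R e $ j)"
        by (subst (2) fg[symmetric]) (simp add: y_def r_def frac_def algebra_simps sum_subtractf)
      then have y: "y \<in> L" using diff[OF x sum] by simp
      define b where "b = (\<chi> j. if j = k then y else e $ j)"
      have "b = (\<chi> i. if i = k then sum (\<lambda>i. r$i *s row i e) UNIV else row i e)"
        by (simp add: b_def y_def row_def vec_eq_iff sum_component)
      then have db: "det b = frac (g x $ k) * det e"
        using cramer_lemma_transpose[of k r e] by (simp add: r_def)
      have "P b" using db nz de y eL by (simp add: P_def b_def)
      have "frac (g x $ k) < 1" "frac (g x $ k) \<ge> 0" by (auto simp: frac_lt_1)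
      then have "(frac (g x $ k))\<^sup>2 < 1" by (simp add: power_less_one_iff abs_square_less_1)
      then have "(det b)\<^sup>2 < (det e)\<^sup>2"
        using de by (simp add: db power_mult_distrib)
      then have "real (\<mu> b) < real (\<mu> e)"
        using \<mu>[OF e] \<mu>[OF \<open>P b\<close>] C by simp
      then show False using min[OF \<open>P b\<close>] by simp
    qed
    have "x = (\<Sum>k\<in>UNIV. of_int ((\<chi> k. \<lfloor>g x $ k\<rfloor>) $ k) *\<^sub>R e $ k)"
      using frac by (subst fg[symmetric]) (simp add: frac_def)
    then show "x \<in> range (\<lambda>c::int^'n. \<Sum>k\<in>UNIV. of_int (c $ k) *\<^sub>R e $ k)" by blast
  qed
  with de that show ?thesis by blast
qed

text \<open>The tuple \<open>b\<close> is an integer matrix times \<open>e\<close>. Thus every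
  integral basis is nondegenerate, not just the one constructed above.\<close>

lemma Zbasis_det_nonzero:
  fixes e :: "real^'n^'n"
  assumes e: "is_Zbasis (*\<^sub>R) e L" and b: "\<forall>k. b $ k \<in> L" "det b \<noteq> 0"
  shows "det e \<noteq> 0"
proof -
  have "\<forall>k. \<exists>c::int^'n. b $ k = (\<Sum>j\<in>UNIV. of_int (c $ j) *\<^sub>R e $ j)"
    using e b(1) by (auto simp: is_Zbasis_def bij_betw_def)
  then obtain c :: "'n \<Rightarrow> int^'n" where c: "\<And>k. b $ k = (\<Sum>j\<in>UNIV. of_int (c k $ j) *\<^sub>R e $ j)"
    by metis
  have "b = (\<chi> k j. of_int (c k $ j)) ** e"
    by (simp add: vec_eq_iff c matrix_matrix_mult_def sum_component)
  then show ?thesis using b(2) by (auto simp: det_mul)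
qed

lemma det_gram:
  fixes e :: "real^'n^'n"
  shows "det (\<chi> k l. r * (e $ k \<bullet> e $ l)) = r ^ CARD('n) * (det e)\<^sup>2"
proof -
  have "(\<chi> k l. r * (e $ k \<bullet> e $ l)) = (\<chi> k. r *s ((e ** transpose e) $ k))"
    by (simp add: vec_eq_iff matrix_matrix_mult_def transpose_def inner_vec_def)
  also have "det \<dots> = r ^ CARD('n) * det (e ** transpose e)"
    by (subst det_rows_mul) simp
  finally show ?thesis by (simp add: det_mul det_transpose power2_eq_square)
qed

text \<open>A generator of an ideal of the integers is unique up to sign, so exactly one natural
  number qualifies for the \<open>LEAST\<close> in \<open>ideal_abs\<close>.\<close>

lemma ideal_abs_Idl:
  assumes "m \<in> X" "\<And>x. x \<in> X \<Longrightarrow> m dvd x"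
  shows "ideal_abs (Idl\<^bsub>\<Z>\<^esub> X) = nat \<bar>m\<bar>"
proof -
  have "X \<subseteq> Idl\<^bsub>\<Z>\<^esub> {m}"
    using assms(2) by (auto simp: int_Idl dvd_def mult.commute)
  then have "Idl\<^bsub>\<Z>\<^esub> X = Idl\<^bsub>\<Z>\<^esub> {m}"
    using assms(1) int.genideal_ideal[of X] int.genideal_self[of X] int.genideal_ideal[of "{m}"]
    by (intro equalityI int.genideal_minimal) auto
  then have "Idl\<^bsub>\<Z>\<^esub> X = Idl\<^bsub>\<Z>\<^esub> {int k} \<longleftrightarrow> k = nat \<bar>m\<bar>" for k
  proof -
    have "k = nat \<bar>m\<bar> \<longleftrightarrow> int k dvd m \<and> m dvd int k"
    proof
      assume "int k dvd m \<and> m dvd int k"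
      then have "\<bar>int k\<bar> = \<bar>m\<bar>" using zdvd_antisym_abs by blast
      then show "k = nat \<bar>m\<bar>" by linarith
    qed auto
    then show ?thesis
      using dvds_eq_Idl[of "int k" m] \<open>Idl\<^bsub>\<Z>\<^esub> X = Idl\<^bsub>\<Z>\<^esub> {m}\<close> by metis
  qed
  then show ?thesis
    unfolding ideal_abs_def by (auto intro: Least_equality simp only:)
qed

section \<open>Lattices with integral trace form, embedded in Euclidean space\<close>

lemma det_Ints: "det A \<in> \<int>" if "\<And>i j. A $ i $ j \<in> \<int>" for A :: "real^'n^'n"
  unfolding det_def by (intro Ints_sum Ints_mult Ints_prod that) auto

text \<open>Common frame for \<open>embed2\<close>, \<open>embed3\<close> and \<open>embed4\<close>.
  Injectivity is asked on \<open>L\<close> only, because \<open>embed3\<close> forgets the fourth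
  coordinate; \<open>gram\<close> is integrality of the trace form, which is twice the inner
  product.\<close>

locale embedded_lattice =
  fixes s :: "'k::ring_1 \<Rightarrow> 'v \<Rightarrow> 'v::ab_group_add"
    and f :: "'v \<Rightarrow> real^'n::{finite,wellorder}" and L :: "'v set"
  assumes diff: "x \<in> L \<Longrightarrow> y \<in> L \<Longrightarrow> x - y \<in> L"
    and scale: "x \<in> L \<Longrightarrow> s (of_int m) x \<in> L"
    and f_add: "f (x + y) = f x + f y"
    and f_scale: "f (s (of_int m) x) = of_int m *\<^sub>R f x"
    and inj: "inj_on f L"
    and gram: "x \<in> L \<Longrightarrow> y \<in> L \<Longrightarrow> 2 * (f x \<bullet> f y) \<in> \<int>"
    and full: "\<exists>b :: 'v^'n::_. (\<forall>k. b $ k \<in> L) \<and> det (\<chi> k. f (b $ k)) \<noteq> 0"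
begin

lemma f_sum: "f (\<Sum>k\<in>I. s (of_int (c k)) (e k)) = (\<Sum>k\<in>I. of_int (c k) *\<^sub>R f (e k))"
proof -
  have "f 0 = 0" using f_add[of 0 0] by simp
  then show ?thesis by (induction I rule: infinite_finite_induct) (simp_all add: f_add f_scale)
qed

lemma sum_closed: "(\<And>k. k \<in> I \<Longrightarrow> e k \<in> L) \<Longrightarrow> (\<Sum>k\<in>I. s (of_int (c k)) (e k)) \<in> L"
proof -
  assume e: "\<And>k. k \<in> I \<Longrightarrow> e k \<in> L"
  obtain x where "x \<in> L" using full by blast
  then have zero: "0 \<in> L" using diff[of x x] by simp
  have add: "x + y \<in> L" if "x \<in> L" "y \<in> L" for x y
    using diff[OF that(1) diff[OF zero that(2)]] by simp
  show ?thesis using e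
    by (induction I rule: infinite_finite_induct) (auto simp: zero intro: add scale)
qed

lemma f_diff: "f (x - y) = f x - f y"
  using f_add[of "x - y" y] by simp

lemma Zbasis_f:
  fixes e :: "'v^'n::_"
  assumes "is_Zbasis s e L"
  shows "is_Zbasis (*\<^sub>R) (\<chi> k. f (e $ k)) (f ` L)"
proof -
  have "bij_betw (f \<circ> (\<lambda>c::int^'n::_. \<Sum>k\<in>UNIV. s (of_int (c $ k)) (e $ k))) UNIV (f ` L)"
    using bij_betw_trans[OF assms[unfolded is_Zbasis_def] inj_on_imp_bij_betw[OF inj]] .
  then show ?thesis by (simp add: is_Zbasis_def comp_def f_sum)
qed

text \<open>The basis is found in the Euclidean image, where determinants measure tuples, and is
  pulled back along the injective \<open>f\<close>.\<close>

lemma Zbasis_ex: "\<exists>e :: 'v^'n::_. is_Zbasis s e L \<and> (\<forall>k. e $ k \<in> L)"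
proof -
  have diff': "x - y \<in> f ` L" if "x \<in> f ` L" "y \<in> f ` L" for x y
    using that diff by (auto simp flip: f_diff)
  have disc: "2 ^ CARD('n) * (det b)\<^sup>2 \<in> \<int>" if "\<forall>k. b $ k \<in> f ` L" for b :: "real^'n::_^'n::_"
    unfolding det_gram[symmetric]
  proof (rule det_Ints)
    fix i j
    obtain x y where "x \<in> L" "y \<in> L" "b $ i = f x" "b $ j = f y" using \<open>\<forall>k. b $ k \<in> f ` L\<close> by (meson imageE)
    then show "(\<chi> k l. 2 * (b $ k \<bullet> b $ l)) $ i $ j \<in> \<int>" using gram by simp
  qed
  obtain b :: "'v^'n::_" where b: "\<forall>k. b $ k \<in> L" "det (\<chi> k. f (b $ k)) \<noteq> 0"
    using full by blast
  obtain e' where e': "is_Zbasis (*\<^sub>R) e' (f ` L)" "det e' \<noteq> 0"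
    using b by (auto intro: Zbasis_exists[OF diff' disc, of "\<chi> k. f (b $ k)"])
  have "e' $ k \<in> f ` L" for k
  proof -
    have "(\<Sum>j\<in>UNIV. of_int ((axis k 1 :: int^'n::_) $ j) *\<^sub>R (e' $ j)) \<in> f ` L"
      using e'(1) unfolding is_Zbasis_def bij_betw_def by blast
    also have "(\<Sum>j\<in>UNIV. of_int ((axis k 1 :: int^'n::_) $ j) *\<^sub>R (e' $ j))
        = (\<Sum>j\<in>UNIV. if j = k then e' $ j else 0)"
      by (intro sum.cong) (auto simp: axis_def)
    finally show ?thesis by simp
  qed
  then have "\<exists>x\<in>L. e' $ k = f x" for k by blast
  then obtain e0 where e0: "\<And>k. e0 k \<in> L" "\<And>k. e' $ k = f (e0 k)"
    by metis
  define e where "e = (\<chi> k. e0 k)"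
  define g where "g c = (\<Sum>k\<in>UNIV. s (of_int (c $ k)) (e $ k))" for c :: "int^'n::_"
  have eL: "e $ k \<in> L" for k by (simp add: e_def e0)
  have e'e: "e' = (\<chi> k. f (e $ k))" by (simp add: vec_eq_iff e_def e0)
  have gL: "g c \<in> L" for c unfolding g_def using eL by (intro sum_closed)
  have bij: "bij_betw (\<lambda>c. f (g c)) UNIV (f ` L)"
    using e'(1) by (simp add: is_Zbasis_def g_def f_sum e'e)
  have "bij_betw g UNIV L"
    unfolding bij_betw_def
  proof (intro conjI subset_antisym subsetI)
    show "inj g" using bij by (auto simp: bij_betw_def inj_on_def)
    fix x assume x: "x \<in> L"
    then obtain c where "f x = f (g c)" using bij by (auto simp: bij_betw_def)
    then have "x = g c" using inj x gL by (auto simp: inj_on_def)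
    then show "x \<in> range g" by blast
  qed (use gL in auto)
  then have "is_Zbasis s e L" by (simp add: is_Zbasis_def g_def[abs_def])
  then show ?thesis using eL by blast
qed

lemma covolume_eq:
  fixes e :: "'v^'n::_"
  assumes "is_Zbasis s e L"
  shows "covolume (f ` L) = \<bar>det (\<chi> k. f (e $ k))\<bar>"
proof -
  obtain b :: "'v^'n::_" where b: "\<forall>k. b $ k \<in> L" "det (\<chi> k. f (b $ k)) \<noteq> 0"
    using full by blast
  then have "det (\<chi> k. f (e $ k)) \<noteq> 0"
    by (intro Zbasis_det_nonzero[OF Zbasis_f[OF assms], of "\<chi> k. f (b $ k)"]) auto
  then show ?thesis by (rule covolume_Zbasis[OF Zbasis_f[OF assms]])
qed

text \<open>\<open>Q\<close> stands for the determinant equation in \<open>quad_disc\<close> or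
  \<open>quat_disc\<close>, posed in complex or in rational numbers. All bases give the same
  integer, so the generating set is a singleton. The factor \<open>sqrt (2 ^ CARD('n))\<close> is 2
  for rank 2 and 4 for rank 4, which explains the denominators in dimensions 3 and 5.\<close>

lemma sqrt_ideal_abs_gram:
  assumes Q: "\<And>m (e :: 'v^'n::_). is_Zbasis s e L \<Longrightarrow>
    Q m e \<longleftrightarrow> real_of_int m = det (\<chi> k l. 2 * (f (e $ k) \<bullet> f (e $ l)))"
  shows "sqrt (real (ideal_abs (Idl\<^bsub>\<Z>\<^esub> {m. \<exists>e :: 'v^'n::_. is_Zbasis s e L \<and> Q m e})))
    = sqrt (2 ^ CARD('n)) * covolume (f ` L)" (is "sqrt (real (ideal_abs (Idl\<^bsub>\<Z>\<^esub> ?X))) = _")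
proof -
  have det: "det (\<chi> k l. 2 * (f (e $ k) \<bullet> f (e $ l))) = 2 ^ CARD('n) * (covolume (f ` L))\<^sup>2"
    if "is_Zbasis s e L" for e :: "'v^'n::_"
    using det_gram[of 2 "\<chi> k. f (e $ k)"] covolume_eq[OF that] by simp
  then have X: "real_of_int m = 2 ^ CARD('n) * (covolume (f ` L))\<^sup>2" if "m \<in> ?X" for m
    using that Q by auto
  obtain e :: "'v^'n::_" where e: "is_Zbasis s e L" "\<And>k. e $ k \<in> L"
    using Zbasis_ex by blast
  have "det (\<chi> k l. 2 * (f (e $ k) \<bullet> f (e $ l))) \<in> \<int>"
    using gram e(2) by (intro det_Ints) auto
  then obtain m where m: "det (\<chi> k l. 2 * (f (e $ k) \<bullet> f (e $ l))) = of_int m"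
    by (auto elim: Ints_cases)
  then have mX: "m \<in> ?X" using e Q by auto
  have "ideal_abs (Idl\<^bsub>\<Z>\<^esub> ?X) = nat \<bar>m\<bar>"
  proof (rule ideal_abs_Idl[OF mX])
    fix x assume "x \<in> ?X"
    then have "real_of_int x = real_of_int m" using X X[OF mX] by metis
    then show "m dvd x" by simp
  qed
  then have "real (ideal_abs (Idl\<^bsub>\<Z>\<^esub> ?X)) = 2 ^ CARD('n) * (covolume (f ` L))\<^sup>2"
    using X[OF mX] by simp
  then show ?thesis
    using covolume_eq[OF e(1)] by (simp add: real_sqrt_mult)
qed

end

section \<open>Rings of integers of imaginary quadratic fields\<close>

text \<open>Every power of the denominator divides \<open>D\<close>, so the denominator is 1.
  Integrality of norms rests on this, both in quadratic fields and in quaternion orders.\<close>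

lemma rat_Ints_if_bounded_powers:
  fixes q :: rat
  assumes D: "D \<noteq> 0" "\<And>k. of_int D * q ^ k \<in> \<int>"
  shows "q \<in> \<int>"
proof -
  obtain a b where q: "quotient_of q = (a, b)" by force
  then have b: "b > 0" "coprime a b" and qab: "q = of_int a / of_int b"
    by (auto simp: quotient_of_denom_pos quotient_of_coprime quotient_of_div)
  have "b ^ k dvd D" for k
  proof -
    obtain z where "of_int D * q ^ k = of_int z" using D(2) by (auto elim: Ints_cases)
    then have "of_int (D * a ^ k) = (of_int (z * b ^ k) :: rat)"
      using b(1) by (simp add: qab power_divide field_simps)
    then have "b ^ k dvd D * a ^ k" by (simp only: of_int_eq_iff) simp
    then show ?thesis
      using b(2) by (metis coprime_commute coprime_dvd_mult_left_iff coprime_power_left_iff coprime_power_right_iff)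
  qed
  then have *: "b ^ k \<le> \<bar>D\<bar>" for k
    using D(1) by (metis dvd_abs_iff zdvd_imp_le zero_less_abs_iff)
  have "b = 1"
  proof (rule ccontr)
    assume "b \<noteq> 1"
    then have "2 \<le> b" using b by simp
    then have "(2::int) ^ nat \<bar>D\<bar> \<le> b ^ nat \<bar>D\<bar>" by (intro power_mono) auto
    moreover have "int (nat \<bar>D\<bar>) < 2 ^ nat \<bar>D\<bar>" by (rule of_nat_less_two_power)
    ultimately show False using *[of "nat \<bar>D\<bar>"] by simp
  qed
  then show ?thesis by (simp add: qab)
qed

lemma complex_of_real_of_rat: "complex_of_real (of_rat q) = of_rat q"
  by (cases q) (simp add: of_rat_rat)

lemma cnj_of_rat: "cnj (of_rat q) = of_rat q"
  by (simp flip: complex_of_real_of_rat)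

lemma imaginary_quadratic_field_coordinates:
  assumes K: "imaginary_quadratic_field K" and z: "z \<in> K" "z \<notin> \<real>" and w: "w \<in> K"
  shows "\<exists>p q. w = of_rat p + of_rat q * z"
proof -
  interpret V: vector_space "\<lambda>(q::rat) (z::complex). of_rat q * z"
    by unfold_locales (simp_all add: algebra_simps of_rat_add of_rat_mult)
  have "V.dim K = 2" using K by (simp add: imaginary_quadratic_field_def)
  then obtain B where B: "K \<subseteq> V.span B" "card B = 2"
    using V.basis_exists[of K] by metis
  then have fB: "finite B" by (metis card.infinite zero_neq_numeral)
  have "1 \<in> K" using K by (simp add: imaginary_quadratic_field_def)
  have z1: "z \<notin> V.span {1}"
  proof
    assume "z \<in> V.span {1}"
    then obtain q where "z = of_rat q" by (auto simp: V.span_singleton)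
    then show False using z(2) by (metis Reals_of_real complex_of_real_of_rat)
  qed
  have ind: "V.independent {z, 1}"
    using z1 by (intro V.independent_insertI) (auto simp: V.independent_empty)
  have "w \<in> V.span {z, 1}"
  proof (rule ccontr)
    assume nw: "w \<notin> V.span {z, 1}"
    then have "V.independent {w, z, 1}" using ind by (rule V.independent_insertI)
    moreover have "{w, z, 1} \<subseteq> V.span B" using B z w \<open>1 \<in> K\<close> by auto
    ultimately have "card {w, z, 1} \<le> card B" using V.independent_span_bound[OF fB] by blast
    moreover have "w \<noteq> z" "w \<noteq> 1" "z \<noteq> 1"
      using nw z1 V.span_base[of _ "{z, 1}"] V.span_base[of 1 "{1}"] by blast+
    ultimately show False using B(2) by simp
  qed
  then obtain q p where "w - of_rat q * z = of_rat p * 1"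
    by (auto simp: V.span_breakdown_eq[of w z] V.span_singleton)
  then have "w = of_rat p + of_rat q * z" by (simp add: algebra_simps)
  then show ?thesis by blast
qed

text \<open>The relation expressing \<open>z * z\<close> through 1 and \<open>z\<close> has rational
  coefficients \<open>p\<close> and \<open>q\<close>, so \<open>cnj z\<close> satisfies it too.
  Subtracting and cancelling \<open>z - cnj z\<close> gives trace \<open>q\<close> and norm
  \<open>- p\<close>.\<close>

lemma imaginary_quadratic_field_trace_norm:
  assumes K: "imaginary_quadratic_field K" and z: "z \<in> K" "z \<notin> \<real>"
  obtains t n where "z + cnj z = of_rat t" "z * cnj z = of_rat n"
proof -
  have "z * z \<in> K" using K z by (auto simp: imaginary_quadratic_field_def)
  then obtain p q where pq: "z * z = of_rat p + of_rat q * z"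
    using imaginary_quadratic_field_coordinates[OF K z] by blast
  then have "cnj z * cnj z = of_rat p + of_rat q * cnj z"
    by (metis cnj_of_rat complex_cnj_add complex_cnj_mult)
  with pq have "(z - cnj z) * (z + cnj z) = (z - cnj z) * of_rat q"
    by (simp add: algebra_simps)
  moreover have "z - cnj z \<noteq> 0" using z(2) by (metis Reals_cnj_iff eq_iff_diff_eq_0)
  ultimately have t: "z + cnj z = of_rat q" by simp
  then have "z * cnj z = z * (of_rat q - z)" by (metis add_diff_cancel_left')
  also have "\<dots> = of_rat (- p)" using pq by (simp add: algebra_simps of_rat_minus)
  finally show ?thesis using t that by blast
qed

text \<open>A common denominator for the powers of \<open>z\<close> below the degree of a monic
  integral equation serves for all powers, by the recurrence that this equation gives. The degree
  may exceed 2: integrality of the quadratic equation of \<open>z\<close> is still to be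
  shown.\<close>

lemma bounded_denominators_of_powers:
  fixes z :: complex
  assumes rat: "\<And>k. \<exists>p q. z ^ k = of_rat p + of_rat q * z" and z: "algebraic_int z"
  obtains N :: int where "N > 0" "\<And>k. \<exists>u v. of_int N * z ^ k = of_int u + of_int v * z"
proof -
  define G where "G = {of_int u + of_int v * z | u v. True}"
  have G0: "0 \<in> G" unfolding G_def by (rule CollectI, rule exI[of _ 0], rule exI[of _ 0]) simp
  have Gadd: "x + y \<in> G" if "x \<in> G" "y \<in> G" for x y
  proof -
    from that obtain u v u' v' where "x = of_int u + of_int v * z" "y = of_int u' + of_int v' * z"
      unfolding G_def by blast
    then have "x + y = of_int (u + u') + of_int (v + v') * z" by (simp add: algebra_simps)
    then show ?thesis unfolding G_def by blast
  qed
  have Gmul: "of_int m * x \<in> G" if "x \<in> G" for m x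
  proof -
    from that obtain u v where "x = of_int u + of_int v * z" unfolding G_def by blast
    then have "of_int m * x = of_int (m * u) + of_int (m * v) * z" by (simp add: algebra_simps)
    then show ?thesis unfolding G_def by blast
  qed
  have Gsum: "(\<Sum>i\<in>S. f i) \<in> G" if "\<And>i. i \<in> S \<Longrightarrow> f i \<in> G" for f and S :: "nat set"
    using that by (induction S rule: infinite_finite_induct) (auto simp: G0 intro: Gadd)
  obtain P where P: "lead_coeff P = 1" "\<And>i. coeff P i \<in> \<int>" "poly P z = 0"
    using z by (auto elim: algebraic_int.cases)
  define m where "m = degree P"
  have "\<exists>N>0. \<forall>i<l. of_int N * z ^ i \<in> G" for l
  proof (induction l)
    case (Suc l)
    then obtain N :: int where N: "N > 0" "\<And>i. i < l \<Longrightarrow> of_int N * z ^ i \<in> G" by blast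
    obtain p q where pq: "z ^ l = of_rat p + of_rat q * z" using rat by blast
    obtain a b c d where ab: "quotient_of p = (a, b)" and cd: "quotient_of q = (c, d)" by force
    then have bd: "b > 0" "d > 0" using quotient_of_denom_pos by auto
    have "of_int (N * b * d) * z ^ l = of_int (N * d * a) + of_int (N * b * c) * z"
      unfolding pq quotient_of_div[OF ab] quotient_of_div[OF cd]
      using bd by (simp add: of_rat_divide field_simps)
    then have "of_int (N * b * d) * z ^ l \<in> G" unfolding G_def by blast
    moreover have "of_int (N * b * d) * z ^ i \<in> G" if "i < l" for i
      using Gmul[OF N(2)[OF that], of "b * d"] by (simp add: mult_ac)
    ultimately show ?case using N(1) bd by (intro exI[of _ "N * b * d"]) (auto simp: less_Suc_eq)
  qed (auto intro: exI[of _ 1])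
  then obtain N :: int where N: "N > 0" "\<And>i. i < m \<Longrightarrow> of_int N * z ^ i \<in> G" by blast
  have "of_int N * z ^ k \<in> G" for k
  proof (induction k rule: less_induct)
    case (less k)
    show ?case
    proof (cases "k < m")
      case False
      have "0 = (\<Sum>i\<le>m. coeff P i * z ^ i)" using P(3) by (simp add: poly_altdef m_def)
      also have "\<dots> = (\<Sum>i<m. coeff P i * z ^ i) + z ^ m"
        using P(1) by (simp add: m_def flip: lessThan_Suc_atMost)
      finally have zm: "z ^ m = - (\<Sum>i<m. coeff P i * z ^ i)" by (simp add: eq_neg_iff_add_eq_0 add.commute)
      have "of_int N * z ^ k = of_int N * z ^ (k - m) * z ^ m"
        using False by (simp add: mult.assoc flip: power_add)
      also have "\<dots> = (\<Sum>i<m. - coeff P i * (of_int N * z ^ (k - m + i)))"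
        by (simp add: zm sum_distrib_left sum_negf power_add algebra_simps)
      also have "\<dots> \<in> G"
      proof (rule Gsum)
        fix i assume "i \<in> {..<m}"
        then have "of_int N * z ^ (k - m + i) \<in> G" using False by (intro less) auto
        moreover obtain c where "coeff P i = of_int c" using P(2)[of i] by (auto elim: Ints_cases)
        ultimately show "- coeff P i * (of_int N * z ^ (k - m + i)) \<in> G"
          using Gmul[of "of_int N * z ^ (k - m + i)" "- c"] by simp
      qed
      finally show ?thesis .
    qed (use N in auto)
  qed
  then have "\<exists>u v. of_int N * z ^ k = of_int u + of_int v * z" for k
    unfolding G_def by blast
  with N(1) that show ?thesis by blast
qed

text \<open>The norm of \<open>N * z ^ k\<close> is \<open>N\<^sup>2 * n ^ k\<close>. Computed from
  the integral coordinates \<open>u\<close> and \<open>v\<close>, it is an integral combination of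
  1, \<open>t\<close> and \<open>n\<close>, so the powers of \<open>n\<close> have bounded
  denominators.\<close>

lemma algebraic_int_norm_Ints:
  assumes t: "z + cnj z = of_rat t" and n: "z * cnj z = of_rat n" and N: "N \<noteq> 0"
    and u: "\<And>k. \<exists>u v. of_int N * z ^ k = of_int u + of_int v * z"
  shows "n \<in> \<int>"
proof -
  obtain a b c d where ab: "quotient_of t = (a, b)" and cd: "quotient_of n = (c, d)" by force
  then have bd: "b > 0" "d > 0" using quotient_of_denom_pos by auto
  show ?thesis
  proof (rule rat_Ints_if_bounded_powers)
    show "b * d * N\<^sup>2 \<noteq> 0" using bd N by simp
    fix k
    obtain u v where uv: "of_int N * z ^ k = of_int u + of_int v * z" using u by blast
    have "of_int (N\<^sup>2) * (z * cnj z) ^ k = (of_int N * z ^ k) * cnj (of_int N * z ^ k)"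
      by (simp add: power2_eq_square power_mult_distrib)
    also have "\<dots> = of_int (u\<^sup>2) + of_int (u * v) * (z + cnj z) + of_int (v\<^sup>2) * (z * cnj z)"
      unfolding uv by (simp add: algebra_simps power2_eq_square)
    finally have "(of_rat (of_int (N\<^sup>2) * n ^ k) :: complex)
        = of_rat (of_int (u\<^sup>2) + of_int (u * v) * t + of_int (v\<^sup>2) * n)"
      unfolding t n by (simp add: of_rat_add of_rat_mult of_rat_power)
    then have "of_int (N\<^sup>2) * n ^ k = of_int (u\<^sup>2) + of_int (u * v) * t + of_int (v\<^sup>2) * n"
      by (simp only: of_rat_eq_iff)
    then have "of_int (b * d * N\<^sup>2) * n ^ k = of_int (b * d) * (of_int (u\<^sup>2) + of_int (u * v) * t + of_int (v\<^sup>2) * n)"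
      by (simp only: of_int_mult mult.assoc)
    also have "\<dots> = of_int (b * d * u\<^sup>2 + u * v * a * d + v\<^sup>2 * c * b)"
      unfolding quotient_of_div[OF ab] quotient_of_div[OF cd]
      using bd by (simp add: field_simps)
    finally show "of_int (b * d * N\<^sup>2) * n ^ k \<in> \<int>" by simp
  qed
qed

lemma ring_of_integers_trace_norm:
  assumes K: "imaginary_quadratic_field K" and z: "z \<in> ring_of_integers K"
  obtains t n :: int where "z + cnj z = of_int t" "z * cnj z = of_int n"
proof (cases "z \<in> \<real>")
  case True
  obtain y where y: "y \<in> K" "y \<notin> \<real>" using K by (auto simp: imaginary_quadratic_field_def)
  have zK: "z \<in> K" "algebraic_int z" using z by (auto simp: ring_of_integers_def)
  obtain p q where pq: "z = of_rat p + of_rat q * y"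
    using imaginary_quadratic_field_coordinates[OF K y zK(1)] by blast
  have "Im z = 0" "Im y \<noteq> 0" using True y by (auto simp: complex_is_Real_iff)
  moreover have "Im z = of_rat q * Im y"
    unfolding pq by (simp flip: complex_of_real_of_rat)
  ultimately have "q = 0" by simp
  then have "z \<in> \<rat>" using pq by simp
  then have "z \<in> \<int>" using zK rational_algebraic_int_is_int by blast
  then obtain m where "z = of_int m" by (auto elim: Ints_cases)
  then have "z + cnj z = of_int (2 * m)" "z * cnj z = of_int (m * m)" by simp_all
  then show ?thesis using that by blast
next
  case False
  have zK: "z \<in> K" "algebraic_int z" using z by (auto simp: ring_of_integers_def)
  obtain t n where tn: "z + cnj z = of_rat t" "z * cnj z = of_rat n"
    using imaginary_quadratic_field_trace_norm[OF K zK(1) False] .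
  have "1 \<in> K" "\<And>x. x \<in> K \<Longrightarrow> x * z \<in> K"
    using K zK by (auto simp: imaginary_quadratic_field_def)
  then have pow: "z ^ k \<in> K" for k
    by (induction k) (simp_all add: mult.commute[of z])
  then have "\<exists>p q. z ^ k = of_rat p + of_rat q * z" for k
    using imaginary_quadratic_field_coordinates[OF K zK(1) False] by blast
  then obtain N :: int where N: "N > 0" "\<And>k. \<exists>u v. of_int N * z ^ k = of_int u + of_int v * z"
    using bounded_denominators_of_powers zK(2) by blast
  have n: "n \<in> \<int>" using algebraic_int_norm_Ints[OF tn _ N(2)] N(1) by simp
  \<comment> \<open>The trace is reached through the norm of \<open>z + 1\<close>, which is
    \<open>n + t + 1\<close>.\<close>
  have tn1: "(z + 1) + cnj (z + 1) = of_rat (t + 2)" "(z + 1) * cnj (z + 1) = of_rat (n + t + 1)"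
    using tn by (simp_all add: algebra_simps of_rat_add flip: tn)
  \<comment> \<open>By the binomial theorem the bound \<open>N\<close> for the powers of
    \<open>z\<close> also serves for those of \<open>z + 1\<close>.\<close>
  have "\<exists>u v. of_int N * (z + 1) ^ k = of_int u + of_int v * (z + 1)" for k
  proof -
    obtain u v where uv: "\<And>i. of_int N * z ^ i = of_int (u i) + of_int (v i) * z"
      using N(2) by metis
    have "of_int N * (z + 1) ^ k = (\<Sum>i\<le>k. of_nat (k choose i) * (of_int N * z ^ i))"
      by (simp add: binomial_ring sum_distrib_left mult_ac)
    also have "\<dots> = (\<Sum>i\<le>k. of_int (int (k choose i) * u i)) + (\<Sum>i\<le>k. of_int (int (k choose i) * v i)) * z"
      by (simp add: uv sum_distrib_left sum.distrib algebra_simps)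
    also have "\<dots> = of_int ((\<Sum>i\<le>k. int (k choose i) * u i) - (\<Sum>i\<le>k. int (k choose i) * v i))
        + of_int (\<Sum>i\<le>k. int (k choose i) * v i) * (z + 1)"
      by (simp add: algebra_simps)
    finally show ?thesis by blast
  qed
  then have "n + t + 1 \<in> \<int>" using algebraic_int_norm_Ints[OF tn1, of N] N(1) by blast
  then have "t \<in> \<int>" using n by (metis Ints_1 Ints_diff add_diff_cancel_right' add_diff_cancel_left')
  with n tn that show ?thesis by (auto elim!: Ints_cases)
qed

lemma algebraic_int_trace_norm:
  fixes z :: complex
  assumes "z + cnj z = of_int t" "z * cnj z = of_int n"
  shows "algebraic_int z"
proof -
  define P :: "complex poly" where "P = [:of_int n, - of_int t, 1:]"
  have "cnj z = of_int t - z" using assms(1) by (simp add: algebra_simps)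
  then have "z * (of_int t - z) = of_int n" using assms(2) by simp
  then have "poly P z = 0" by (simp add: P_def algebra_simps)
  moreover have "coeff P i \<in> \<int>" for i by (auto simp: P_def coeff_pCons split: nat.split)
  moreover have "lead_coeff P = 1" by (simp add: P_def)
  ultimately show ?thesis by (intro algebraic_int.intros) auto
qed

text \<open>The number \<open>z \<cdot> cnj w\<close> has norm \<open>p q\<close>; its trace \<open>T\<close> is a rational root of a monic integral
  quadratic polynomial whose other root is the trace of \<open>z w\<close>.\<close>

lemma ring_of_integers_trace_form:
  assumes K: "imaginary_quadratic_field K"
    and z: "z \<in> ring_of_integers K" and w: "w \<in> ring_of_integers K"
  shows "z * cnj w + cnj z * w \<in> \<int>"
proof -
  obtain s p where s: "z + cnj z = of_int s" "z * cnj z = of_int p"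
    using ring_of_integers_trace_norm[OF K z] .
  obtain t q where t: "w + cnj w = of_int t" "w * cnj w = of_int q"
    using ring_of_integers_trace_norm[OF K w] .
  define T where "T = z * cnj w + cnj z * w"
  have K': "z \<in> K" "w \<in> K" "z * w \<in> K"
    using z w K by (auto simp: ring_of_integers_def imaginary_quadratic_field_def)
  have rat: "x + cnj x \<in> \<rat>" if "x \<in> K" for x
  proof (cases "x \<in> \<real>")
    case False
    then show ?thesis using imaginary_quadratic_field_trace_norm[OF K that] by (metis Rats_of_rat)
  next
    case True
    obtain y where y: "y \<in> K" "y \<notin> \<real>" using K by (auto simp: imaginary_quadratic_field_def)
    obtain a b where ab: "x = of_rat a + of_rat b * y"
      using imaginary_quadratic_field_coordinates[OF K y \<open>x \<in> K\<close>] by blast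
    obtain c where c: "y + cnj y = of_rat c"
      using imaginary_quadratic_field_trace_norm[OF K y] by blast
    have "x + cnj x = of_rat a + of_rat a + of_rat b * (y + cnj y)"
      unfolding ab by (simp add: cnj_of_rat algebra_simps)
    then show ?thesis unfolding c by simp
  qed
  have st: "T = of_int (s * t) - (z * w + cnj (z * w))"
    unfolding T_def of_int_mult s(1)[symmetric] t(1)[symmetric] by (simp add: algebra_simps)
  then have "T \<in> \<rat>" using rat[OF K'(3)] by simp
  moreover have "algebraic_int T"
  proof -
    \<comment> \<open>\<open>m\<close> is the product of the traces of \<open>z * cnj w\<close> and
      \<open>z * w\<close>, whose sum is \<open>s * t\<close>.\<close>
    define m where "m = q * (s\<^sup>2 - 2 * p) + p * (t\<^sup>2 - 2 * q)"
    have "T * (z * w + cnj (z * w)) = (w * cnj w) * (z\<^sup>2 + (cnj z)\<^sup>2) + (z * cnj z) * (w\<^sup>2 + (cnj w)\<^sup>2)"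
      unfolding T_def by (simp add: algebra_simps power2_eq_square)
    also have "z\<^sup>2 + (cnj z)\<^sup>2 = (z + cnj z)\<^sup>2 - 2 * (z * cnj z)"
      by (simp add: algebra_simps power2_eq_square)
    also have "w\<^sup>2 + (cnj w)\<^sup>2 = (w + cnj w)\<^sup>2 - 2 * (w * cnj w)"
      by (simp add: algebra_simps power2_eq_square)
    finally have "T * (z * w + cnj (z * w)) = of_int m"
      unfolding s t by (simp add: m_def)
    then have root: "T * (of_int (s * t) - T) = of_int m" using st by simp
    define P :: "complex poly" where "P = [:of_int m, - of_int (s * t), 1:]"
    have "poly P T = 0" using root by (simp add: P_def algebra_simps)
    moreover have "coeff P i \<in> \<int>" for i by (auto simp: P_def coeff_pCons split: nat.split)
    moreover have "lead_coeff P = 1" by (simp add: P_def)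
    ultimately show ?thesis by (intro algebraic_int.intros) auto
  qed
  ultimately show ?thesis unfolding T_def using rational_algebraic_int_is_int by blast
qed

text \<open>Integrality is read off from trace and norm: the norm of \<open>z - w\<close> is
  \<open>p + q - r\<close>, with \<open>r\<close> the value of the trace form.\<close>

lemma ring_of_integers_diff:
  assumes K: "imaginary_quadratic_field K"
    and z: "z \<in> ring_of_integers K" and w: "w \<in> ring_of_integers K"
  shows "z - w \<in> ring_of_integers K"
proof -
  obtain s p where s: "z + cnj z = of_int s" "z * cnj z = of_int p"
    using ring_of_integers_trace_norm[OF K z] .
  obtain t q where t: "w + cnj w = of_int t" "w * cnj w = of_int q"
    using ring_of_integers_trace_norm[OF K w] .
  obtain r where r: "z * cnj w + cnj z * w = of_int r"
    using ring_of_integers_trace_form[OF K z w] by (auto elim: Ints_cases)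
  have "(z - w) + cnj (z - w) = of_int (s - t)"
    by (simp add: algebra_simps flip: s t)
  moreover have "(z - w) * cnj (z - w) = of_int (p + q - r)"
    by (simp add: algebra_simps flip: s t r)
  ultimately have "algebraic_int (z - w)" by (rule algebraic_int_trace_norm)
  then show ?thesis using z w K by (auto simp: ring_of_integers_def imaginary_quadratic_field_def)
qed

lemma ring_of_integers_nonreal:
  assumes K: "imaginary_quadratic_field K"
  obtains z where "z \<in> ring_of_integers K" "z \<notin> \<real>"
proof -
  obtain y where y: "y \<in> K" "y \<notin> \<real>" using K by (auto simp: imaginary_quadratic_field_def)
  obtain t n where tn: "y + cnj y = of_rat t" "y * cnj y = of_rat n"
    using imaginary_quadratic_field_trace_norm[OF K y] .
  obtain a b c d where ab: "quotient_of t = (a, b)" and cd: "quotient_of n = (c, d)" by force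
  then have bd: "b > 0" "d > 0" using quotient_of_denom_pos by auto
  \<comment> \<open>The factor clears the denominators of both the trace and the norm of
    \<open>y\<close>.\<close>
  define z where "z = of_int (b * d) * y"
  have "z + cnj z = of_int (b * d) * (y + cnj y)" by (simp add: z_def algebra_simps)
  also have "\<dots> = of_int (a * d)"
    unfolding tn quotient_of_div[OF ab] using bd by (simp add: of_rat_divide)
  finally have 1: "z + cnj z = of_int (a * d)" .
  have "z * cnj z = (of_int (b * d))\<^sup>2 * (y * cnj y)" by (simp add: z_def algebra_simps power2_eq_square)
  also have "\<dots> = of_int (b\<^sup>2 * d * c)"
    unfolding tn quotient_of_div[OF cd] using bd by (simp add: of_rat_divide power2_eq_square)
  finally have "z * cnj z = of_int (b\<^sup>2 * d * c)" .
  with 1 have "algebraic_int z" by (rule algebraic_int_trace_norm)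
  have K0: "x - x' \<in> K" if "x \<in> K" "x' \<in> K" for x x'
    using K that by (auto simp: imaginary_quadratic_field_def)
  have "of_nat m * y \<in> K" for m
  proof (induction m)
    case 0 then show ?case using K0[OF y(1) y(1)] by simp
  next
    case (Suc m)
    have "of_nat m * y - (0 - y) \<in> K" using K0[OF y(1) y(1)] Suc y(1) by (intro K0) auto
    then show ?case by (simp add: algebra_simps)
  qed
  from this[of "nat (b * d)"] have "z \<in> K" using bd by (simp add: z_def)
  moreover have "z \<notin> \<real>" using y(2) bd by (auto simp: z_def complex_is_Real_iff)
  ultimately show ?thesis using that \<open>algebraic_int z\<close> by (auto simp: ring_of_integers_def)
qed

lemma inj_embed2: "inj embed2"
  by (rule injI) (simp add: embed2_def vec_eq_iff forall_2 complex_eq_iff)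

lemma embedded_lattice_ring_of_integers:
  assumes K: "imaginary_quadratic_field K"
  shows "embedded_lattice (*) embed2 (ring_of_integers K)"
proof
  fix x y and m :: int
  assume x: "x \<in> ring_of_integers K"
  obtain t n :: int where "x + cnj x = of_int t" "x * cnj x = of_int n"
    using ring_of_integers_trace_norm[OF K x] .
  have zero: "0 \<in> ring_of_integers K" using ring_of_integers_diff[OF K x x] by simp
  have add: "u + v \<in> ring_of_integers K" if "u \<in> ring_of_integers K" "v \<in> ring_of_integers K" for u v
    using ring_of_integers_diff[OF K that(1) ring_of_integers_diff[OF K zero that(2)]] by simp
  have nat: "of_nat k * x \<in> ring_of_integers K" for k
    by (induction k) (auto simp: zero algebra_simps intro: add x)
  show "of_int m * x \<in> ring_of_integers K"
  proof (cases m rule: int_cases2)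
    case (nonpos k)
    then show ?thesis using ring_of_integers_diff[OF K zero nat[of k]] by simp
  qed (use nat in simp)
  assume y: "y \<in> ring_of_integers K"
  show "x - y \<in> ring_of_integers K" by (rule ring_of_integers_diff[OF K x y])
  obtain k where "x * cnj y + cnj x * y = of_int k"
    using ring_of_integers_trace_form[OF K x y] by (auto elim: Ints_cases)
  moreover have "x * cnj y + cnj x * y = complex_of_real (2 * (embed2 x \<bullet> embed2 y))"
    using embed2_isometry[of x y] by (simp add: ctr_def mult.commute)
  ultimately have "complex_of_real (2 * (embed2 x \<bullet> embed2 y)) = complex_of_real (of_int k)" by simp
  then have "2 * (embed2 x \<bullet> embed2 y) = of_int k" by (simp only: of_real_eq_iff)
  then show "2 * (embed2 x \<bullet> embed2 y) \<in> \<int>" by simp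
next
  show "embed2 (x + y) = embed2 x + embed2 y" for x y
    by (simp add: embed2_def vec_eq_iff forall_2)
  show "embed2 (of_int m * x) = of_int m *\<^sub>R embed2 x" for m x
    by (simp add: embed2_def vec_eq_iff forall_2)
  show "inj_on embed2 (ring_of_integers K)" by (rule inj_on_subset[OF inj_embed2]) simp
  obtain z where z: "z \<in> ring_of_integers K" "z \<notin> \<real>"
    using ring_of_integers_nonreal[OF K] .
  have "1 \<in> ring_of_integers K"
    using K by (auto simp: ring_of_integers_def imaginary_quadratic_field_def)
  then have "\<forall>k. (vector [1, z] :: complex^2) $ k \<in> ring_of_integers K"
    using z by (simp add: forall_2)
  moreover have "det (\<chi> k. embed2 ((vector [1, z] :: complex^2) $ k)) \<noteq> 0"
    using z(2) by (simp add: det_2 embed2_def complex_is_Real_iff)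
  ultimately show "\<exists>b :: complex^2. (\<forall>k. b $ k \<in> ring_of_integers K) \<and> det (\<chi> k. embed2 (b $ k)) \<noteq> 0"
    by blast
qed

theorem covolume_ring_of_integers:
  assumes K: "imaginary_quadratic_field K"
  shows "covolume (embed2 ` ring_of_integers K)
    = sqrt (real (ideal_abs (quad_disc (ring_of_integers K)))) / 2"
proof -
  have "of_int m = det (\<chi> k l. ctr (e $ k * cnj (e $ l))) \<longleftrightarrow>
      real_of_int m = det (\<chi> k l. 2 * (embed2 (e $ k) \<bullet> embed2 (e $ l)))" for m and e :: "complex^2"
  proof -
    have "ctr (x * cnj y) = complex_of_real (2 * (embed2 x \<bullet> embed2 y))" for x y
      using embed2_isometry[of x y] by (simp add: mult.commute)
    then have "det (\<chi> k l. ctr (e $ k * cnj (e $ l)))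
        = complex_of_real (det (\<chi> k l. 2 * (embed2 (e $ k) \<bullet> embed2 (e $ l))))"
      by (simp add: det_2)
    moreover have "of_int m = complex_of_real (of_int m)" by simp
    ultimately show ?thesis by (simp only: of_real_eq_iff)
  qed
  from embedded_lattice.sqrt_ideal_abs_gram[OF embedded_lattice_ring_of_integers[OF K] this] show ?thesis
    by (simp add: quad_disc_def)
qed

section \<open>Orders in rational definite quaternion algebras\<close>

lemma of_rat_det: "of_rat (det A) = det (\<chi> i j. of_rat (A $ i $ j))" for A :: "rat^'n^'n"
proof -
  have "of_rat (of_int (sign p)) = of_int (sign p)" for p :: "'n \<Rightarrow> 'n"
    by (rule of_rat_of_int_eq)
  then show ?thesis
    unfolding det_def by (simp add: of_rat_sum of_rat_mult of_rat_prod)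
qed

lemma of_rat_Ints_iff: "(of_rat q :: real) \<in> \<int> \<longleftrightarrow> q \<in> \<int>"
proof
  assume "(of_rat q :: real) \<in> \<int>"
  then obtain m where "(of_rat q :: real) = of_rat (of_int m)" by (auto elim: Ints_cases)
  then show "q \<in> \<int>" by (simp only: of_rat_eq_iff) simp
qed (auto elim!: Ints_cases)

lemma subgroup_add:
  fixes G :: "'a::ab_group_add set"
  assumes "\<And>x y. x \<in> G \<Longrightarrow> y \<in> G \<Longrightarrow> x - y \<in> G" "x \<in> G" "y \<in> G"
  shows "x + y \<in> G"
  using assms(1)[OF assms(2) assms(1)[OF assms(1)[OF assms(3) assms(3)] assms(3)]] by simp

lemma subgroup_scale_int:
  fixes G :: "(rat^'n) set"
  assumes G: "\<And>x y. x \<in> G \<Longrightarrow> y \<in> G \<Longrightarrow> x - y \<in> G" and x: "x \<in> G"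
  shows "of_int m *s x \<in> G"
proof -
  have zero: "0 \<in> G" using G[OF x x] by simp
  have nat: "of_nat k *s x \<in> G" for k
  proof (induction k)
    case 0 then show ?case using zero by simp
  next
    case (Suc k)
    have "x + of_nat k *s x \<in> G" by (rule subgroup_add[OF G x Suc])
    then show ?case by (simp add: vec_eq_iff algebra_simps)
  qed
  show ?thesis
  proof (cases m rule: int_cases2)
    case (nonpos k)
    have "0 - of_nat k *s x \<in> G" by (rule G[OF zero nat])
    then show ?thesis using nonpos by (simp add: vec_eq_iff)
  qed (use nat in simp)
qed

section \<open>Finitely generated subgroups and full lattices\<close>

definition zspan :: "(rat^'n) set \<Rightarrow> (rat^'n) set" where
  "zspan B = {\<Sum>v\<in>B. of_int (c v) *s v | c :: rat^'n \<Rightarrow> int. True}"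

lemma zspan_diff: "x \<in> zspan B \<Longrightarrow> y \<in> zspan B \<Longrightarrow> x - y \<in> zspan B"
proof -
  assume "x \<in> zspan B" "y \<in> zspan B"
  then obtain c d where "x = (\<Sum>v\<in>B. of_int (c v) *s v)" "y = (\<Sum>v\<in>B. of_int (d v) *s v)"
    unfolding zspan_def by blast
  then have "x - y = (\<Sum>v\<in>B. of_int (c v - d v) *s v)"
    by (simp add: sum_subtractf vector_sub_rdistrib)
  then show ?thesis
    unfolding zspan_def by (intro CollectI exI[of _ "\<lambda>v. c v - d v"]) simp
qed

lemma zspan_base:
  assumes "finite B" "v \<in> B"
  shows "v \<in> zspan B"
proof -
  have "v = (\<Sum>w\<in>B. if w = v then v else 0)" using assms by simp
  also have "\<dots> = (\<Sum>w\<in>B. of_int (if w = v then 1 else 0) *s w)"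
    by (intro sum.cong) auto
  finally show ?thesis
    unfolding zspan_def by (intro CollectI exI[of _ "\<lambda>w. if w = v then 1 else 0"]) simp
qed

lemma zspan_minimal:
  assumes G: "\<And>x y. x \<in> G \<Longrightarrow> y \<in> G \<Longrightarrow> x - y \<in> G" "0 \<in> G" and B: "B \<subseteq> G"
  shows "zspan B \<subseteq> G"
proof -
  have "(\<Sum>v\<in>S. of_int (c v) *s v) \<in> G" if "S \<subseteq> B" for c and S
    using that
  proof (induction S rule: infinite_finite_induct)
    case (insert v S)
    then have "of_int (c v) *s v \<in> G" "(\<Sum>v\<in>S. of_int (c v) *s v) \<in> G"
      using B subgroup_scale_int[OF G(1)] by auto
    then show ?case using insert subgroup_add[OF G(1)] by simp
  qed (use G in simp_all)
  then show ?thesis unfolding zspan_def by blast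
qed

lemma is_full_lattice_iff:
  "is_full_lattice L \<longleftrightarrow> (\<exists>B. finite B \<and> L = zspan B) \<and> vec.span L = UNIV"
  unfolding is_full_lattice_def zspan_def by blast

text \<open>Both enlargements of an order made below add a finitely generated subgroup; this settles
  that the result is a lattice.\<close>

lemma is_full_lattice_extend:
  assumes L: "is_full_lattice L" and C: "finite C"
  shows "is_full_lattice {x + y | x y. x \<in> L \<and> y \<in> zspan C}" (is "is_full_lattice ?S")
proof -
  obtain B where B: "finite B" "L = zspan B" and span: "vec.span L = UNIV"
    using L by (auto simp: is_full_lattice_iff)
  have z: "0 \<in> zspan A" for A :: "(rat^4) set"
    unfolding zspan_def by (rule CollectI, rule exI[of _ "\<lambda>_. 0"]) simp
  have sub: "zspan A \<subseteq> zspan (B \<union> C)" if "A \<subseteq> B \<union> C" for A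
    using that B C by (intro zspan_minimal zspan_diff z) (auto intro: zspan_base)
  have "?S = zspan (B \<union> C)"
  proof
    show "?S \<subseteq> zspan (B \<union> C)"
      using sub[of B] sub[of C] by (auto simp: B(2) intro!: subgroup_add[of "zspan (B \<union> C)"] zspan_diff)
    show "zspan (B \<union> C) \<subseteq> ?S"
    proof (rule zspan_minimal)
      fix x y assume "x \<in> ?S" "y \<in> ?S"
      then obtain x1 x2 y1 y2 where "x1 \<in> L" "y1 \<in> L" "x2 \<in> zspan C" "y2 \<in> zspan C"
        "x = x1 + x2" "y = y1 + y2" by blast
      then have "x - y = (x1 - y1) + (x2 - y2)" "x1 - y1 \<in> L" "x2 - y2 \<in> zspan C"
        unfolding B(2) by (auto intro: zspan_diff)
      then show "x - y \<in> ?S" by blast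
    next
      show "0 \<in> ?S" using z B(2) by force
      show "B \<union> C \<subseteq> ?S"
      proof
        fix v assume "v \<in> B \<union> C"
        then show "v \<in> ?S"
        proof
          assume "v \<in> B"
          then have "v = v + 0" "v \<in> L" using zspan_base B by auto
          then show ?thesis using z by blast
        next
          assume "v \<in> C"
          then have "v = 0 + v" "v \<in> zspan C" using zspan_base C by auto
          then show ?thesis using z B(2) by blast
        qed
      qed
    qed
  qed
  moreover have "L \<subseteq> ?S" using z by force
  then have "vec.span ?S = UNIV" using span vec.span_mono[of L ?S] by blast
  ultimately show ?thesis
    unfolding is_full_lattice_iff using B C by blast
qed

text \<open>This is the scalar \<open>qmult a b u (qconj u)\<close>, written out as a quadratic form
  in the coordinates.\<close>

definition qnrm :: "rat \<Rightarrow> rat \<Rightarrow> rat^4 \<Rightarrow> rat" where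
  "qnrm a b u = (u$1)\<^sup>2 - a * (u$2)\<^sup>2 - b * (u$3)\<^sup>2 + a * b * (u$4)\<^sup>2"

lemma qnrm_qmult: "qnrm a b (qmult a b u v) = qnrm a b u * qnrm a b v"
  by (simp add: qnrm_def qmult_def power2_eq_square algebra_simps)

lemma qnrm_one: "qnrm a b (qscalar 1) = 1"
  by (simp add: qnrm_def)

lemma qnrm_bounded_denominators:
  "\<exists>D>0. \<forall>u. (\<forall>i. of_int N * u $ i \<in> \<int>) \<longrightarrow> of_int (D * N\<^sup>2) * qnrm a b u \<in> \<int>"
proof -
  obtain p q r s where pq: "quotient_of a = (p, q)" and rs: "quotient_of b = (r, s)" by force
  then have qs: "q > 0" "s > 0" using quotient_of_denom_pos by auto
  have "of_int (q * s * N\<^sup>2) * qnrm a b u \<in> \<int>" if u: "\<forall>i. of_int N * u $ i \<in> \<int>" for u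
  proof -
    have "of_int (q * s * N\<^sup>2) * qnrm a b u
      = of_int (q * s) * (of_int N * u $ 1)\<^sup>2 - of_int (p * s) * (of_int N * u $ 2)\<^sup>2
        - of_int (q * r) * (of_int N * u $ 3)\<^sup>2 + of_int (p * r) * (of_int N * u $ 4)\<^sup>2"
    proof -
      have "of_int p = of_int q * a" "of_int r = of_int s * b"
        using quotient_of_div[OF pq] quotient_of_div[OF rs] qs by auto
      then show ?thesis by (simp add: qnrm_def algebra_simps power2_eq_square)
    qed
    also have "\<dots> \<in> \<int>"
      by (intro Ints_add Ints_diff Ints_mult Ints_power u[rule_format] Ints_of_int)
    finally show ?thesis .
  qed
  then show ?thesis using qs by (intro exI[of _ "q * s"]) auto
qed

section \<open>Quaternion orders: integrality, embeddings and covolume\<close>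

locale quaternion_order =
  fixes a b :: rat and R :: "(rat^4) set"
  assumes neg: "a < 0" "b < 0" and order: "is_order a b R"
begin

lemma diff: "x \<in> R \<Longrightarrow> y \<in> R \<Longrightarrow> x - y \<in> R"
  using order zspan_diff by (auto simp: is_order_def is_full_lattice_iff)

lemma one: "qscalar 1 \<in> R" and mult: "x \<in> R \<Longrightarrow> y \<in> R \<Longrightarrow> qmult a b x y \<in> R"
  using order by (auto simp: is_order_def)

lemma add: "x \<in> R \<Longrightarrow> y \<in> R \<Longrightarrow> x + y \<in> R"
  by (rule subgroup_add[OF diff])

lemma scale: "x \<in> R \<Longrightarrow> of_int m *s x \<in> R"
  by (rule subgroup_scale_int[OF diff])

lemma zero: "0 \<in> R" and uminus: "x \<in> R \<Longrightarrow> - x \<in> R"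
  using diff[OF one one] diff[of 0 x] by auto

lemma scalar_int: "qscalar (of_int m) \<in> R"
proof -
  have "qscalar (of_int m) = of_int m *s qscalar 1" by (simp add: vec_eq_iff forall_4)
  then show ?thesis using scale[OF one] by simp
qed

lemma bounded_denominators: "\<exists>N>0. \<forall>x\<in>R. \<forall>i. of_int N * x $ i \<in> \<int>"
proof -
  have ex: "\<exists>N>0. of_int N * q \<in> \<int>" for q :: rat
  proof -
    obtain c d where cd: "quotient_of q = (c, d)" by force
    then have "d > 0" "of_int d * q = of_int c"
      using quotient_of_denom_pos[OF cd] quotient_of_div[OF cd] by auto
    then show ?thesis by (metis Ints_of_int)
  qed
  define den where "den q = (SOME N. N > 0 \<and> of_int N * q \<in> \<int>)" for q :: rat
  have den: "den q > 0" "of_int (den q) * q \<in> \<int>" for q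
    using someI_ex[OF ex[of q]] unfolding den_def by auto
  obtain B where B: "finite B" "R = zspan B"
    using order by (auto simp: is_order_def is_full_lattice_iff)
  define N where "N = (\<Prod>v\<in>B. \<Prod>i\<in>UNIV. den (v $ i))"
  have "N > 0" unfolding N_def using den by (intro prod_pos) auto
  moreover have "R \<subseteq> {x. \<forall>i. of_int N * x $ i \<in> \<int>}"
    unfolding B(2)
  proof (rule zspan_minimal)
    show "B \<subseteq> {x. \<forall>i. of_int N * x $ i \<in> \<int>}"
    proof safe
      fix v i assume v: "v \<in> B"
      have "den (v $ i) dvd (\<Prod>i\<in>UNIV. den (v $ i))" by (rule dvd_prodI) auto
      also have "\<dots> dvd N" unfolding N_def using B v by (intro dvd_prodI)
      finally obtain k where "N = den (v $ i) * k" by blast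
      then have "of_int N * v $ i = of_int k * (of_int (den (v $ i)) * v $ i)" by simp
      then show "of_int N * v $ i \<in> \<int>" by (simp only: Ints_mult Ints_of_int den)
    qed
  qed (simp_all add: right_diff_distrib)
  ultimately show ?thesis by blast
qed

text \<open>Finite generation bounds the denominators of all norms from \<open>R\<close>, and the
  powers of the norm of \<open>x\<close> are norms of powers of \<open>x\<close>.\<close>

lemma nrm_Ints:
  assumes x: "x \<in> R"
  shows "qnrm a b x \<in> \<int>"
proof -
  obtain N :: int where N: "N > 0" "\<And>y i. y \<in> R \<Longrightarrow> of_int N * y $ i \<in> \<int>"
    using bounded_denominators by blast
  obtain D :: int where D: "D > 0"
    "\<And>u. \<forall>i. of_int N * u $ i \<in> \<int> \<Longrightarrow> of_int (D * N\<^sup>2) * qnrm a b u \<in> \<int>"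
    using qnrm_bounded_denominators by blast
  show ?thesis
  proof (rule rat_Ints_if_bounded_powers)
    show "D * N\<^sup>2 \<noteq> 0" using N D by simp
    fix k
    have "\<exists>y\<in>R. qnrm a b y = qnrm a b x ^ k"
    proof (induction k)
      case 0 then show ?case using one qnrm_one by auto
    next
      case (Suc k)
      then obtain y where "y \<in> R" "qnrm a b y = qnrm a b x ^ k" by blast
      then show ?case using mult[OF x] by (intro bexI[of _ "qmult a b x y"]) (auto simp: qnrm_qmult)
    qed
    then obtain y where "y \<in> R" "qnrm a b y = qnrm a b x ^ k" by blast
    then show "of_int (D * N\<^sup>2) * qnrm a b x ^ k \<in> \<int>" using D(2)[of y] N(2)[of y] by simp
  qed
qed

text \<open>The trace is the polarisation of the norm at 1.\<close>

lemma trace_Ints: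
  assumes x: "x \<in> R"
  shows "2 * x $ 1 \<in> \<int>"
proof -
  have "2 * x $ 1 = qnrm a b (x + qscalar 1) - qnrm a b x - 1"
    by (simp add: qnrm_def power2_eq_square algebra_simps)
  then show ?thesis using nrm_Ints[OF x] nrm_Ints[OF add[OF x one]] by simp
qed

lemma conj_closed:
  assumes x: "x \<in> R"
  shows "qconj x \<in> R"
proof -
  obtain m where "2 * x $ 1 = of_int m" using trace_Ints[OF x] by (auto elim: Ints_cases)
  then have "qconj x = qscalar (of_int m) - x"
    by (auto simp: qconj_def vec_eq_iff forall_4)
  then show ?thesis using diff[OF scalar_int x] by simp
qed

lemma trace_form_Ints: "x \<in> R \<Longrightarrow> y \<in> R \<Longrightarrow> qtr (qmult a b x (qconj y)) \<in> \<int>"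
  using trace_Ints[OF mult[OF _ conj_closed]] by (simp add: qtr_def qconj_def)

text \<open>Supplies the nondegenerate tuples: multiples of the coordinate vectors lie in
  \<open>R\<close>.\<close>

lemma multiple_in_order: "\<exists>m>0. of_int m *s x \<in> R"
proof -
  have "x \<in> vec.span R" using order by (simp add: is_order_def is_full_lattice_iff)
  then show ?thesis
  proof (induction rule: vec.span_induct_alt)
    case base
    show ?case using zero by (intro exI[of _ 1]) simp
  next
    case (step c x y)
    then obtain m where m: "m > 0" "of_int m *s y \<in> R" by blast
    obtain p q where pq: "quotient_of c = (p, q)" by force
    then have q: "q > 0" and c: "c = of_int p / of_int q"
      using quotient_of_denom_pos quotient_of_div by auto
    have "of_int (m * q) *s (c *s x + y) = of_int (m * p) *s x + of_int q *s (of_int m *s y)"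
      using q by (simp add: vec_eq_iff c field_simps)
    also have "\<dots> \<in> R" by (intro add scale step(1) m(2))
    finally show ?case using m q by (intro exI[of _ "m * q"]) simp
  qed
qed

lemma two_inner_embed4:
  "2 * (embed4 a b x \<bullet> embed4 a b y) = of_rat (qtr (qmult a b x (qconj y)))"
  by (simp add: embed4_isometry[OF neg] of_rat_divide)

lemma sqrt_pos: "sqrt (of_rat (- a)) > 0" "sqrt (of_rat (- b)) > 0" "sqrt (of_rat (a * b)) > 0"
  using neg by (simp_all add: zero_less_of_rat_iff mult_neg_neg)

lemma embedded_lattice_embed4: "embedded_lattice (*s) (embed4 a b) R"
proof
  show "embed4 a b (x + y) = embed4 a b x + embed4 a b y" for x y
    by (simp add: embed4_def vec_eq_iff forall_4 of_rat_add algebra_simps)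
  show "embed4 a b (of_int m *s x) = of_int m *\<^sub>R embed4 a b x" for m x
    by (simp add: embed4_def vec_eq_iff forall_4 of_rat_mult)
  show "inj_on (embed4 a b) R"
    using sqrt_pos by (intro inj_onI) (simp add: embed4_def vec_eq_iff forall_4)
  show "2 * (embed4 a b x \<bullet> embed4 a b y) \<in> \<int>" if "x \<in> R" "y \<in> R" for x y
    using trace_form_Ints[OF that] by (simp add: two_inner_embed4 of_rat_Ints_iff)
  have "\<forall>k. \<exists>m>0. of_int m *s axis k 1 \<in> R" using multiple_in_order by blast
  then obtain m :: "4 \<Rightarrow> int" where m: "\<And>k. m k > 0" "\<And>k. of_int (m k) *s axis k 1 \<in> R" by metis
  have m0: "m k \<noteq> 0" for k using m(1)[of k] by simp
  define B :: "rat^4^4" where "B = (\<chi> k. of_int (m k) *s axis k 1)"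
  have "det (\<chi> k. embed4 a b (B $ k)) = (\<Prod>k\<in>UNIV. (\<chi> k. embed4 a b (B $ k)) $ k $ k)"
  proof (rule det_diagonal)
    fix i j :: 4 assume "i \<noteq> j"
    then show "(\<chi> k. embed4 a b (B $ k)) $ i $ j = 0"
      using exhaust_4[of i] exhaust_4[of j] by (auto simp: B_def embed4_def axis_def)
  qed
  also have "\<dots> \<noteq> 0"
  proof -
    have "(\<chi> k. embed4 a b (B $ k)) $ k $ k \<noteq> 0" for k
      using exhaust_4[of k] neg m0[of k] by (auto simp: B_def embed4_def axis_def)
    then show ?thesis by simp
  qed
  finally show "\<exists>B :: rat^4^4. (\<forall>k. B $ k \<in> R) \<and> det (\<chi> k. embed4 a b (B $ k)) \<noteq> 0"
    using m(2) by (intro exI[of _ B]) (simp add: B_def)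
qed (rule diff scale; assumption)+

lemma embedded_lattice_embed3: "embedded_lattice (*s) (embed3 a b) (ddagger_fixed R)"
proof
  have fixed: "x \<in> ddagger_fixed R \<longleftrightarrow> x \<in> R \<and> x $ 4 = 0" for x
    by (auto simp: ddagger_fixed_def ddagger_def vec_eq_iff forall_4)
  show "x - y \<in> ddagger_fixed R" if "x \<in> ddagger_fixed R" "y \<in> ddagger_fixed R" for x y
    using that diff by (simp add: fixed)
  show "of_int m *s x \<in> ddagger_fixed R" if "x \<in> ddagger_fixed R" for m x
    using that scale by (simp add: fixed)
  show "embed3 a b (x + y) = embed3 a b x + embed3 a b y" for x y
    by (simp add: embed3_def vec_eq_iff forall_3 of_rat_add algebra_simps)
  show "embed3 a b (of_int m *s x) = of_int m *\<^sub>R embed3 a b x" for m x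
    by (simp add: embed3_def vec_eq_iff forall_3 of_rat_mult)
  show "inj_on (embed3 a b) (ddagger_fixed R)"
    using sqrt_pos by (intro inj_onI) (simp add: fixed embed3_def vec_eq_iff forall_3 forall_4)
  show "2 * (embed3 a b x \<bullet> embed3 a b y) \<in> \<int>" if "x \<in> ddagger_fixed R" "y \<in> ddagger_fixed R" for x y
  proof -
    have "2 * (embed3 a b x \<bullet> embed3 a b y) = of_rat (qtr (qmult a b x (qconj y)))"
      using that by (simp add: embed3_isometry[OF neg] ddagger_fixed_def of_rat_divide)
    then show ?thesis using trace_form_Ints that by (simp add: of_rat_Ints_iff fixed)
  qed
  define u :: "3 \<Rightarrow> rat^4" where
    "u k = (if k = 1 then axis 1 1 else if k = 2 then axis 2 1 else axis 3 1)" for k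
  have "\<forall>k. \<exists>m>0. of_int m *s u k \<in> R" using multiple_in_order by blast
  then obtain m :: "3 \<Rightarrow> int" where m: "\<And>k. m k > 0" "\<And>k. of_int (m k) *s u k \<in> R" by metis
  have m0: "m k \<noteq> 0" for k using m(1)[of k] by simp
  define B :: "rat^4^3" where "B = (\<chi> k. of_int (m k) *s u k)"
  have "det (\<chi> k. embed3 a b (B $ k)) \<noteq> 0"
    using neg m0 by (simp add: det_3 B_def u_def embed3_def axis_def)
  moreover have "u k $ 4 = 0" for k by (simp add: u_def axis_def)
  ultimately show "\<exists>B :: rat^4^3. (\<forall>k. B $ k \<in> ddagger_fixed R) \<and> det (\<chi> k. embed3 a b (B $ k)) \<noteq> 0"
    using m(2) by (intro exI[of _ B]) (simp add: B_def fixed)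
qed

text \<open>Stated for an arbitrary order so that it serves the \<open>ddagger\<close> case as
  well.\<close>

theorem covolume_order:
  "covolume (embed4 a b ` R) = sqrt (real (ideal_abs (quat_disc a b R))) / 4"
proof -
  have "of_int m = det (\<chi> k l. qtr (qmult a b (e $ k) (qconj (e $ l)))) \<longleftrightarrow>
      real_of_int m = det (\<chi> k l. 2 * (embed4 a b (e $ k) \<bullet> embed4 a b (e $ l)))"
    for m and e :: "rat^4^4"
  proof -
    have "real_of_int m = of_rat (of_int m)" by simp
    moreover have "det (\<chi> k l. 2 * (embed4 a b (e $ k) \<bullet> embed4 a b (e $ l)))
        = of_rat (det (\<chi> k l. qtr (qmult a b (e $ k) (qconj (e $ l)))))"
      by (simp add: of_rat_det two_inner_embed4)
    ultimately show ?thesis by (simp only: of_rat_eq_iff)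
  qed
  from embedded_lattice.sqrt_ideal_abs_gram[OF embedded_lattice_embed4 this]
  show ?thesis by (simp add: quat_disc_def)
qed

end

section \<open>Maximal orders with involution\<close>

lemma zspan_image:
  fixes f :: "rat^'n \<Rightarrow> rat^'m"
  assumes B: "finite B" and f: "\<And>x y. f (x - y) = f x - f y"
  shows "zspan (f ` B) = f ` zspan B"
proof
  have z: "0 \<in> zspan A" for A :: "(rat^'k) set"
    unfolding zspan_def by (rule CollectI, rule exI[of _ "\<lambda>_. 0"]) simp
  have f0: "f 0 = 0" using f[of 0 0] by simp
  show "zspan (f ` B) \<subseteq> f ` zspan B"
  proof (rule zspan_minimal)
    show "0 \<in> f ` zspan B" using z f0 by force
    show "f ` B \<subseteq> f ` zspan B" using zspan_base[OF B] by blast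
    fix x y assume "x \<in> f ` zspan B" "y \<in> f ` zspan B"
    then show "x - y \<in> f ` zspan B" by (auto simp flip: f intro: zspan_diff)
  qed
  have "zspan B \<subseteq> {x. f x \<in> zspan (f ` B)}"
    using B z f0 by (intro zspan_minimal) (auto simp: f intro: zspan_diff zspan_base)
  then show "f ` zspan B \<subseteq> zspan (f ` B)" by blast
qed

lemma zspan_singleton: "zspan {v} = {of_int k *s v | k. True}"
proof -
  have "\<exists>c. k = c v" for k :: int by (rule exI[of _ "\<lambda>_. k"]) simp
  then show ?thesis unfolding zspan_def by auto
qed

lemma qmult_add_left: "qmult a b (x + y) z = qmult a b x z + qmult a b y z"
  and qmult_add_right: "qmult a b z (x + y) = qmult a b z x + qmult a b z y"
  and qmult_diff_left: "qmult a b (x - y) z = qmult a b x z - qmult a b y z"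
  and qmult_diff_right: "qmult a b z (x - y) = qmult a b z x - qmult a b z y"
  and qmult_scale_left: "qmult a b (r *s x) z = r *s qmult a b x z"
  and qmult_scale_right: "qmult a b z (r *s x) = r *s qmult a b z x"
  by (simp_all add: qmult_def vec_eq_iff forall_4 algebra_simps)

lemma qmult_self: "qmult a b x x = (2 * x $ 1) *s x - qscalar (qnrm a b x)"
  by (simp add: qmult_def qnrm_def vec_eq_iff forall_4 power2_eq_square algebra_simps)

text \<open>Polarising \<open>qmult_self\<close> expresses xy + yx through traces; taking away 2yx
  leaves the commutator. The factor 2 is pulled out so that commutators fall into 2R once first
  coordinates are integers.\<close>

lemma qmult_commutator:
  "qmult a b x y - qmult a b y x =
     2 *s (x $ 1 *s y + y $ 1 *s x - qscalar (qmult a b x (qconj y) $ 1) - qmult a b y x)"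
  by (simp add: qmult_def qconj_def vec_eq_iff forall_4 algebra_simps)

lemma qnrm_minus_one: "qnrm a b (x - qscalar 1) = qnrm a b x - 2 * x $ 1 + 1"
  by (simp add: qnrm_def power2_eq_square algebra_simps)

lemma ddagger_ddagger [simp]: "ddagger (ddagger x) = x"
  by (simp add: ddagger_def vec_eq_iff forall_4)

lemma ddagger_add: "ddagger (x + y) = ddagger x + ddagger y"
  and ddagger_scale: "ddagger (r *s x) = r *s ddagger x"
  by (simp_all add: ddagger_def vec_eq_iff forall_4)

text \<open>The map \<open>ddagger (qconj x)\<close> negates the i- and j-coordinates, which is
  conjugation by ij.\<close>

lemma qmult_pure_commute:
  "qmult a b x (quat 0 0 0 t) = qmult a b (quat 0 0 0 t) (ddagger (qconj x))"
  by (simp add: qmult_def qconj_def ddagger_def vec_eq_iff forall_4 algebra_simps)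

section \<open>The discriminant of the involution\<close>

lemma disc_ddagger_eq: "disc_ddagger a b = {- (a * b) * q\<^sup>2 | q. q \<noteq> 0}"
proof safe
  fix x assume "x \<in> disc_ddagger a b"
  then obtain r q \<alpha> where *: "x = r * q\<^sup>2" "q \<noteq> 0" "\<alpha> \<noteq> 0" "ddagger \<alpha> = - \<alpha>" "qmult a b \<alpha> \<alpha> = qscalar r"
    unfolding disc_ddagger_def by blast
  then have \<alpha>: "\<alpha> $ 1 = 0" "\<alpha> $ 2 = 0" "\<alpha> $ 3 = 0" "\<alpha> $ 4 \<noteq> 0"
    by (auto simp: ddagger_def vec_eq_iff forall_4)
  have "r = qmult a b \<alpha> \<alpha> $ 1" using *(5) by simp
  also have "\<dots> = - (a * b) * (\<alpha> $ 4)\<^sup>2" using \<alpha> by (simp add: qmult_def power2_eq_square)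
  finally have "x = - (a * b) * (\<alpha> $ 4 * q)\<^sup>2" using * by (simp add: power_mult_distrib)
  then show "\<exists>q. x = - (a * b) * q\<^sup>2 \<and> q \<noteq> 0"
    using \<alpha>(4) *(2) by (intro exI[of _ "\<alpha> $ 4 * q"]) simp
next
  fix q :: rat assume "q \<noteq> 0"
  moreover have "quat 0 0 0 1 \<noteq> (0 :: rat^4)" "ddagger (quat 0 0 0 1) = - quat 0 0 0 1"
    "qmult a b (quat 0 0 0 1) (quat 0 0 0 1) = qscalar (- (a * b))"
    by (simp_all add: ddagger_def qmult_def vec_eq_iff forall_4)
  ultimately show "- (a * b) * q\<^sup>2 \<in> disc_ddagger a b"
    unfolding disc_ddagger_def by blast
qed

text \<open>Takes the place of the squarefree representative. If \<open>of_int d * s\<^sup>2\<close>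
  is an integer and \<open>s\<close> has denominator \<open>v\<close>, then the square of
  \<open>v\<close> divides \<open>d\<close>, and the quotient is again in the class of
  \<open>c\<close>; minimality gives \<open>v = 1\<close>.\<close>

lemma minimal_square_class:
  fixes c :: rat
  assumes "c > 0"
  obtains d :: int and t :: rat where "d > 0" "t > 0" "of_int d = c * t\<^sup>2"
    "\<And>s :: rat. of_int d * s\<^sup>2 \<in> \<int> \<Longrightarrow> s \<in> \<int>"
proof -
  define P where "P n \<longleftrightarrow> n > 0 \<and> (\<exists>t>0. of_nat n = c * t\<^sup>2)" for n :: nat
  obtain p q where pq: "quotient_of c = (p, q)" by force
  then have q: "q > 0" and c: "c = of_int p / of_int q"
    using quotient_of_denom_pos quotient_of_div by auto
  then have p: "p > 0" using assms by (simp add: zero_less_divide_iff)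
  \<comment> \<open>Some positive integer lies in the class: p/q times the square of q.\<close>
  have "of_nat (nat (p * q)) = c * (of_int q)\<^sup>2"
    using p q by (simp add: c power2_eq_square)
  then have "P (nat (p * q))" unfolding P_def using p q by (auto intro!: exI[of _ "of_int q"])
  then have "P (LEAST n. P n)" by (rule LeastI)
  have min: "(LEAST n. P n) \<le> n" if "P n" for n using that by (rule Least_le)
  define d where "d = (LEAST n. P n)"
  obtain t where d: "d > 0" "t > 0" "of_nat d = c * t\<^sup>2"
    using \<open>P (LEAST n. P n)\<close> P_def[of d] unfolding d_def[symmetric] by blast
  have int: "s \<in> \<int>" if s: "of_int (int d) * s\<^sup>2 \<in> \<int>" for s :: rat
  proof -
    obtain u v where uv: "quotient_of s = (u, v)" by force
    then have v: "v > 0" and cop: "coprime u v" and suv: "s = of_int u / of_int v"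
      by (auto simp: quotient_of_denom_pos quotient_of_div quotient_of_coprime)
    obtain z where "of_int (int d) * s\<^sup>2 = of_int z" using s by (auto elim: Ints_cases)
    then have "of_int (int d * u\<^sup>2) = (of_int (z * v\<^sup>2) :: rat)"
      using v by (simp add: suv power_divide field_simps)
    then have "int d * u\<^sup>2 = z * v\<^sup>2" by (simp only: of_int_eq_iff)
    then have "v\<^sup>2 dvd int d * u\<^sup>2" by simp
    moreover have "coprime (v\<^sup>2) (u\<^sup>2)" using cop by (simp add: coprime_commute)
    ultimately have "v\<^sup>2 dvd int d" by (simp add: coprime_dvd_mult_left_iff)
    then obtain k where k: "int d = v\<^sup>2 * k" by blast
    then have kp: "k > 0" using d(1) v by (metis of_nat_0_less_iff zero_less_mult_pos zero_less_power)
    have "of_nat (nat k) = c * (t / of_int v)\<^sup>2"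
    proof -
      have "of_nat d = of_int v ^ 2 * (of_int k :: rat)"
        using arg_cong[OF k, of "of_int :: int \<Rightarrow> rat"] by simp
      then have "of_int k = c * t\<^sup>2 / (of_int v)\<^sup>2" using d(3) v by (simp add: field_simps)
      then show ?thesis using kp by (simp add: power_divide)
    qed
    then have "P (nat k)" unfolding P_def using kp d(2) v by (auto intro!: exI[of _ "t / of_int v"])
    then have "d \<le> nat k" unfolding d_def by (rule min)
    then have "v\<^sup>2 * k \<le> k" using k kp by linarith
    then have "v\<^sup>2 \<le> 1" using kp by simp
    then have "v = 1" using v by (simp add: abs_square_le_1)
    then show ?thesis by (simp add: suv)
  qed
  show ?thesis
  proof (rule that)
    show "int d > 0" using d(1) by simp
    show "t > 0" by (rule d)
    show "of_int (int d) = c * t\<^sup>2" using d(3) by simp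
  qed (rule int)
qed

text \<open>The class is negative, so the generator is \<open>- d\<close>. An integer in the class
  is \<open>- d\<close> times a rational square, and \<open>min\<close> makes its root an
  integer.\<close>

lemma ideal_abs_iota:
  assumes d: "d > 0" "t > 0" "of_int d = a * b * t\<^sup>2"
    and min: "\<And>s :: rat. of_int d * s\<^sup>2 \<in> \<int> \<Longrightarrow> s \<in> \<int>"
  shows "ideal_abs (iota (disc_ddagger a b)) = nat d"
proof -
  have "ideal_abs (iota (disc_ddagger a b)) = nat \<bar>- d\<bar>"
    unfolding iota_def
  proof (rule ideal_abs_Idl)
    have "of_int (- d) = - (a * b) * t\<^sup>2" using d(3) by simp
    then show "- d \<in> {m. of_int m \<in> disc_ddagger a b}"
      unfolding disc_ddagger_eq using d(2) by blast
    fix m assume "m \<in> {m. of_int m \<in> disc_ddagger a b}"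
    then obtain q where q: "of_int m = - (a * b) * q\<^sup>2" unfolding disc_ddagger_eq by blast
    have m: "of_int m = - (of_int d * (q / t)\<^sup>2)"
      using d(2,3) q by (simp add: power_divide)
    then have "of_int d * (q / t)\<^sup>2 = of_int (- m)" by simp
    then have "of_int d * (q / t)\<^sup>2 \<in> \<int>" by (simp only: Ints_of_int)
    then have "q / t \<in> \<int>" by (rule min)
    then obtain k where "q / t = of_int k" by (auto elim: Ints_cases)
    then have "rat_of_int m = of_int (- d * k\<^sup>2)" using m by simp
    then have "m = - d * k\<^sup>2" by (simp only: of_int_eq_iff)
    then show "- d dvd m" by simp
  qed
  then show ?thesis using d(1) by simp
qed

section \<open>The pure element of a maximal order with involution, and fourth coordinates\<close>

locale maximal_ddagger = quaternion_order +
  fixes d :: int and t :: rat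
  assumes maximal: "maximal_ddagger_order a b R"
    and d: "d > 0" "t > 0" "of_int d = a * b * t\<^sup>2"
    and minimal: "of_int d * (s :: rat)\<^sup>2 \<in> \<int> \<Longrightarrow> s \<in> \<int>"
begin

lemma ddagger_closed: "x \<in> R \<Longrightarrow> ddagger x \<in> R"
  using maximal by (auto simp: maximal_ddagger_order_def ddagger_order_def)

text \<open>Maximality as it is applied to R + \<open>\<beta>\<close> R and to R + Z w/2: only
  closure under product and involution remains to be checked.\<close>

lemma no_extension:
  assumes C: "finite C" and S: "S = {x + y | x y. x \<in> R \<and> y \<in> zspan C}"
    and mult: "\<And>x y. x \<in> S \<Longrightarrow> y \<in> S \<Longrightarrow> qmult a b x y \<in> S"
    and dd: "\<And>x. x \<in> S \<Longrightarrow> ddagger x \<in> S"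
  shows "S = R"
proof -
  have "is_full_lattice R" using order by (simp add: is_order_def)
  then have "is_full_lattice S" unfolding S using C by (rule is_full_lattice_extend)
  moreover have "0 \<in> zspan C"
    unfolding zspan_def by (rule CollectI, rule exI[of _ "\<lambda>_. 0"]) simp
  then have sub: "R \<subseteq> S" unfolding S by force
  ultimately have "is_order a b S"
    unfolding is_order_def using one mult by blast
  moreover have "ddagger ` S = S"
  proof
    show "S \<subseteq> ddagger ` S" using dd by (metis ddagger_ddagger image_eqI subsetI)
  qed (use dd in blast)
  ultimately have "ddagger_order a b S" by (simp add: ddagger_order_def)
  then show ?thesis using maximal sub by (auto simp: maximal_ddagger_order_def)
qed

definition \<beta> :: "rat^4" where "\<beta> = quat 0 0 0 t"

lemma \<beta>_square: "qmult a b \<beta> \<beta> = qscalar (- of_int d)"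
  using d(3) by (simp add: \<beta>_def qmult_def vec_eq_iff forall_4 power2_eq_square)

text \<open>Since \<open>\<beta> R = R \<beta>\<close> and \<open>\<beta>\<^sup>2\<close> is an integer, \<open>R + \<beta> R\<close> is again an order.\<close>

lemma \<beta>_in_order: "\<beta> \<in> R"
proof -
  \<comment> \<open>Conjugation by \<open>\<beta>\<close>; it preserves \<open>R\<close> and moves
    \<open>\<beta>\<close> to the left in products.\<close>
  define \<sigma> where "\<sigma> x = ddagger (qconj x)" for x
  have \<sigma>: "\<sigma> x \<in> R" if "x \<in> R" for x
    unfolding \<sigma>_def using that conj_closed ddagger_closed by blast
  have swap: "qmult a b x \<beta> = qmult a b \<beta> (\<sigma> x)" for x
    unfolding \<beta>_def \<sigma>_def by (rule qmult_pure_commute)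
  obtain B where B: "finite B" "R = zspan B"
    using order by (auto simp: is_order_def is_full_lattice_iff)
  define S where "S = {x + qmult a b \<beta> y | x y. x \<in> R \<and> y \<in> R}"
  have "S = R"
  proof (rule no_extension)
    show "finite (qmult a b \<beta> ` B)" using B by simp
    have "zspan (qmult a b \<beta> ` B) = qmult a b \<beta> ` R"
      unfolding B(2) using B(1) by (rule zspan_image) (rule qmult_diff_right)
    then show "S = {x + y | x y. x \<in> R \<and> y \<in> zspan (qmult a b \<beta> ` B)}"
      unfolding S_def by auto
  next
    fix u v assume "u \<in> S" "v \<in> S"
    then obtain x y z w where R: "x \<in> R" "y \<in> R" "z \<in> R" "w \<in> R"
      and u: "u = x + qmult a b \<beta> y" and v: "v = z + qmult a b \<beta> w"
      unfolding S_def by blast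
    have 1: "qmult a b x (qmult a b \<beta> w) = qmult a b \<beta> (qmult a b (\<sigma> x) w)"
      by (simp add: swap flip: qmult_assoc)
    have "qmult a b (qmult a b \<beta> y) (qmult a b \<beta> w) = qmult a b (qmult a b \<beta> (qmult a b y \<beta>)) w"
      by (simp add: qmult_assoc)
    also have "\<dots> = qmult a b (qmult a b \<beta> \<beta>) (qmult a b (\<sigma> y) w)"
      by (simp add: swap[of y] qmult_assoc)
    also have "\<dots> = qmult a b (qscalar (of_int (- d))) (qmult a b (\<sigma> y) w)"
      by (simp add: \<beta>_square)
    finally have 2: "qmult a b (qmult a b \<beta> y) (qmult a b \<beta> w)
        = qmult a b (qscalar (of_int (- d))) (qmult a b (\<sigma> y) w)" .
    have "qmult a b u v = (qmult a b x z + qmult a b (qscalar (of_int (- d))) (qmult a b (\<sigma> y) w))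
        + qmult a b \<beta> (qmult a b y z + qmult a b (\<sigma> x) w)"
      unfolding u v qmult_add_left qmult_add_right 1 2 by (simp add: qmult_assoc)
    moreover have "qmult a b x z + qmult a b (qscalar (of_int (- d))) (qmult a b (\<sigma> y) w) \<in> R"
      by (intro add mult \<sigma> R scalar_int)
    moreover have "qmult a b y z + qmult a b (\<sigma> x) w \<in> R" by (intro add mult \<sigma> R)
    ultimately show "qmult a b u v \<in> S" unfolding S_def by blast
  next
    fix u assume "u \<in> S"
    then obtain x y where R: "x \<in> R" "y \<in> R" and u: "u = x + qmult a b \<beta> y"
      unfolding S_def by blast
    have "ddagger \<beta> = - \<beta>" by (simp add: \<beta>_def ddagger_def vec_eq_iff forall_4)
    then have "ddagger u = ddagger x + qmult a b (ddagger y) (- \<beta>)"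
      by (simp add: u ddagger_add ddagger_qmult)
    also have "qmult a b (ddagger y) (- \<beta>) = - qmult a b \<beta> (\<sigma> (ddagger y))"
      using qmult_scale_right[of a b "ddagger y" "-1" \<beta>] by (simp add: swap)
    also have "\<dots> = qmult a b \<beta> (- \<sigma> (ddagger y))"
      using qmult_scale_right[of a b \<beta> "-1" "\<sigma> (ddagger y)"] by simp
    finally show "ddagger u \<in> S"
      unfolding S_def using uminus[OF \<sigma>[OF ddagger_closed[OF R(2)]]] ddagger_closed[OF R(1)] by blast
  qed
  moreover have "\<beta> = 0 + qmult a b \<beta> (qscalar 1)" by (simp add: qmult_one)
  then have "\<beta> \<in> S" unfolding S_def using zero one by blast
  ultimately show ?thesis by simp
qed

text \<open>The difference of \<open>x\<close> and \<open>ddagger x\<close> is a multiple of ij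
  lying in \<open>R\<close>, and its norm is \<open>d\<close> times the square of
  \<open>2 * x $ 4 / t\<close>. Minimality of \<open>d\<close> makes this quotient an
  integer.\<close>

lemma fourth_coordinate:
  assumes x: "x \<in> R"
  obtains k :: int where "2 * x $ 4 = of_int k * t"
proof -
  have "x - ddagger x = quat 0 0 0 (2 * x $ 4)"
    by (simp add: ddagger_def vec_eq_iff forall_4)
  then have "qnrm a b (quat 0 0 0 (2 * x $ 4)) \<in> \<int>"
    using nrm_Ints[OF diff[OF x ddagger_closed[OF x]]] by simp
  also have "qnrm a b (quat 0 0 0 (2 * x $ 4)) = of_int d * (2 * x $ 4 / t)\<^sup>2"
    using d(2) by (simp add: qnrm_def d(3) power_divide)
  finally have "2 * x $ 4 / t \<in> \<int>" by (rule minimal)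
  then obtain k where "2 * x $ 4 / t = of_int k" by (elim Ints_cases)
  then have "2 * x $ 4 = of_int k * t" using d(2) by (simp add: field_simps)
  then show ?thesis using that by blast
qed

end

section \<open>Refutation at the prime 2 of the case that no fourth coordinate is a half-integral
  multiple of \<open>t\<close>\<close>

locale integral_fourth_coordinates = maximal_ddagger +
  assumes fourth_integral: "x \<in> R \<Longrightarrow> \<exists>k :: int. x $ 4 = of_int k * t"
begin

text \<open>Left multiplication by \<open>\<beta>\<close> moves the first coordinate, times
  \<open>t\<close>, into the fourth place. All traces are therefore even.\<close>

lemma first_integral:
  assumes x: "x \<in> R"
  shows "x $ 1 \<in> \<int>"
proof -
  obtain k :: int where "qmult a b \<beta> x $ 4 = of_int k * t"
    using fourth_integral[OF mult[OF \<beta>_in_order x]] by blast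
  moreover have "qmult a b \<beta> x $ 4 = x $ 1 * t" by (simp add: \<beta>_def qmult_def)
  ultimately show ?thesis using d(2) by simp
qed

text \<open>The quotient R/2R is never formed; its equations become memberships in
  \<open>R2\<close>.\<close>

definition R2 :: "(rat^4) set" where "R2 = {2 *s x | x. x \<in> R}"

lemma R2I: "x \<in> R \<Longrightarrow> y = 2 *s x \<Longrightarrow> y \<in> R2"
  by (auto simp: R2_def)

lemma R2_diff: "x \<in> R2 \<Longrightarrow> y \<in> R2 \<Longrightarrow> x - y \<in> R2"
proof -
  assume "x \<in> R2" "y \<in> R2"
  then obtain x' y' where "x' \<in> R" "y' \<in> R" "x = 2 *s x'" "y = 2 *s y'" by (auto simp: R2_def)
  then show ?thesis by (intro R2I[OF diff[of x' y']]) (simp_all add: vec.scale_right_diff_distrib)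
qed

lemma R2_add: "x \<in> R2 \<Longrightarrow> y \<in> R2 \<Longrightarrow> x + y \<in> R2"
  by (rule subgroup_add[OF R2_diff])

lemma R2_mult: "x \<in> R \<Longrightarrow> y \<in> R2 \<Longrightarrow> qmult a b x y \<in> R2" "x \<in> R2 \<Longrightarrow> y \<in> R \<Longrightarrow> qmult a b x y \<in> R2"
  unfolding R2_def by (auto simp: qmult_scale_left qmult_scale_right intro: mult)

lemma integer_scale: "q \<in> \<int> \<Longrightarrow> x \<in> R \<Longrightarrow> q *s x \<in> R"
  using scale by (auto elim!: Ints_cases)

lemma scalar_integer: "q \<in> \<int> \<Longrightarrow> qscalar q \<in> R"
  using scalar_int by (auto elim!: Ints_cases)

lemma commutator_R2:
  assumes x: "x \<in> R" and y: "y \<in> R"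
  shows "qmult a b x y - qmult a b y x \<in> R2"
proof (rule R2I)
  show "qmult a b x y - qmult a b y x =
     2 *s (x $ 1 *s y + y $ 1 *s x - qscalar (qmult a b x (qconj y) $ 1) - qmult a b y x)"
    by (rule qmult_commutator)
  show "x $ 1 *s y + y $ 1 *s x - qscalar (qmult a b x (qconj y) $ 1) - qmult a b y x \<in> R"
    by (intro diff add integer_scale scalar_integer first_integral mult conj_closed x y)
qed

text \<open>On \<open>R\<close> the parity of the norm is a ring homomorphism onto the field of two
  elements: it is multiplicative, and additive because the polarisation of the norm is twice an
  integral first coordinate. Its kernel becomes the maximal ideal modulo 2R.\<close>

definition even_nrm :: "rat^4 \<Rightarrow> bool" where
  "even_nrm x \<longleftrightarrow> (\<exists>k :: int. qnrm a b x = 2 * of_int k)"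

lemma even_nrm_cases:
  assumes x: "x \<in> R"
  shows "even_nrm x \<or> even_nrm (x - qscalar 1)"
proof -
  obtain n m :: int where n: "qnrm a b x = of_int n" and m: "x $ 1 = of_int m"
    using nrm_Ints[OF x] first_integral[OF x] by (metis Ints_cases)
  have 1: "qnrm a b (x - qscalar 1) = of_int (n - 2 * m + 1)"
    by (simp add: qnrm_minus_one n m)
  show ?thesis
  proof (cases "even n")
    case True
    then obtain k where "n = 2 * k" by blast
    then show ?thesis using n unfolding even_nrm_def by auto
  next
    case False
    then obtain k where "n = 2 * k + 1" by (blast elim: oddE)
    then have "qnrm a b (x - qscalar 1) = 2 * of_int (k - m + 1)" using 1 by simp
    then show ?thesis unfolding even_nrm_def by blast
  qed
qed

lemma even_nrm_mult: "x \<in> R \<Longrightarrow> even_nrm x \<Longrightarrow> y \<in> R \<Longrightarrow> even_nrm (qmult a b x y)"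
proof -
  assume "x \<in> R" "even_nrm x" "y \<in> R"
  then obtain k m :: int where "qnrm a b x = 2 * of_int k" "qnrm a b y = of_int m"
    using nrm_Ints[of y] unfolding even_nrm_def by (auto elim: Ints_cases)
  then have "qnrm a b (qmult a b x y) = 2 * of_int (k * m)" by (simp add: qnrm_qmult)
  then show ?thesis unfolding even_nrm_def by blast
qed

lemma even_nrm_square:
  assumes x: "x \<in> R" "even_nrm x"
  shows "qmult a b x x \<in> R2"
proof -
  obtain k :: int where k: "qnrm a b x = 2 * of_int k" using x by (auto simp: even_nrm_def)
  show ?thesis
  proof (rule R2I)
    show "qmult a b x x = 2 *s (x $ 1 *s x - qscalar (of_int k))"
      by (simp add: qmult_self k vec_eq_iff forall_4 algebra_simps)
    show "x $ 1 *s x - qscalar (of_int k) \<in> R"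
      by (intro diff integer_scale scalar_int first_integral x)
  qed
qed

text \<open>One of \<open>\<beta>\<close> and \<open>\<beta> - qscalar 1\<close> has even norm. Both
  have fourth coordinate \<open>t\<close>, whereas in 2R it is an even multiple of
  \<open>t\<close>.\<close>

lemma ex_even_nrm: "\<exists>x\<in>R. even_nrm x \<and> x \<notin> R2"
proof -
  have nR2: "x \<notin> R2" if "x $ 4 = t" for x
  proof
    assume "x \<in> R2"
    then obtain y where y: "y \<in> R" "x = 2 *s y" by (auto simp: R2_def)
    obtain k :: int where "y $ 4 = of_int k * t" using fourth_integral[OF y(1)] by blast
    then have "t = of_int (2 * k) * t" using y(2) that by simp
    then have "rat_of_int (2 * k) = of_int 1" using d(2) by simp
    then have "2 * k = 1" by (simp only: of_int_eq_iff)
    then show False by presburger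
  qed
  from even_nrm_cases[OF \<beta>_in_order] show ?thesis
  proof
    assume "even_nrm \<beta>"
    then show ?thesis using \<beta>_in_order nR2[of \<beta>] by (auto simp: \<beta>_def)
  next
    assume "even_nrm (\<beta> - qscalar 1)"
    then show ?thesis using diff[OF \<beta>_in_order one] nR2[of "\<beta> - qscalar 1"] by (auto simp: \<beta>_def)
  qed
qed

text \<open>Modulo \<open>2 R\<close> the order becomes a commutative local ring of order 16 with residue field of two
  elements, in which every element of the maximal ideal squares to zero.  An element whose
  annihilator is as large as possible is killed by the whole maximal ideal.\<close>

lemma basis_mod_2:
  obtains e :: "rat^4^4" where "\<And>k. e $ k \<in> R"
    "\<And>x. x \<in> R \<Longrightarrow> \<exists>c :: int^4. x = (\<Sum>k\<in>UNIV. of_int (c $ k) *s e $ k)"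
    "\<And>c :: int^4. (\<Sum>k\<in>UNIV. of_int (c $ k) *s e $ k) \<in> R2 \<Longrightarrow> \<forall>k. even (c $ k)"
proof -
  obtain e :: "rat^4^4" where e: "is_Zbasis (*s) e R" "\<And>k. e $ k \<in> R"
    using embedded_lattice.Zbasis_ex[OF embedded_lattice_embed4] by blast
  define g where "g c = (\<Sum>k\<in>UNIV. of_int (c $ k) *s e $ k)" for c :: "int^4"
  have bij: "bij_betw g UNIV R" using e(1) by (simp add: is_Zbasis_def g_def[abs_def])
  have "\<exists>c. x = g c" if "x \<in> R" for x using bij that by (auto simp: bij_betw_def)
  moreover have "\<forall>k. even (c $ k)" if c: "g c \<in> R2" for c
  proof -
    obtain y where y: "y \<in> R" "g c = 2 *s y" using c by (auto simp: R2_def)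
    obtain c' where "y = g c'" using bij y(1) by (auto simp: bij_betw_def)
    then have "g c = g (\<chi> k. 2 * c' $ k)"
      using y(2) by (simp add: g_def vec.scale_sum_right)
    then have "c = (\<chi> k. 2 * c' $ k)" using bij by (auto simp: bij_betw_def inj_on_def)
    then show ?thesis by simp
  qed
  ultimately show ?thesis using that e(2) unfolding g_def by blast
qed

lemma finite_representatives: "\<exists>T. finite T \<and> T \<subseteq> R \<and> (\<forall>x\<in>R. \<exists>\<tau>\<in>T. x - \<tau> \<in> R2)"
proof -
  obtain e :: "rat^4^4" where e: "\<And>k. e $ k \<in> R"
    "\<And>x. x \<in> R \<Longrightarrow> \<exists>c :: int^4. x = (\<Sum>k\<in>UNIV. of_int (c $ k) *s e $ k)"
    by (rule basis_mod_2) blast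
  define \<rho> where "\<rho> I = (\<Sum>k\<in>UNIV. of_int (if k \<in> I then 1 else 0) *s e $ k)" for I :: "4 set"
  have sum: "(\<Sum>k\<in>UNIV. of_int (c k) *s e $ k) \<in> R" for c
    by (rule embedded_lattice.sum_closed[OF embedded_lattice_embed4]) (rule e(1))
  have "\<exists>\<tau>\<in>range \<rho>. x - \<tau> \<in> R2" if x: "x \<in> R" for x
  proof -
    obtain c :: "int^4" where c: "x = (\<Sum>k\<in>UNIV. of_int (c $ k) *s e $ k)" using e(2)[OF x] by blast
    have "x - \<rho> {k. odd (c $ k)} = (\<Sum>k\<in>UNIV. of_int (2 * (c $ k div 2)) *s e $ k)"
      unfolding c \<rho>_def sum_subtractf[symmetric] vec.scale_left_diff_distrib[symmetric] of_int_diff[symmetric]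
      by (intro sum.cong refl arg_cong2[where f = "(*s)"] arg_cong[where f = of_int])
        (auto elim!: oddE)
    also have "\<dots> = 2 *s (\<Sum>k\<in>UNIV. of_int (c $ k div 2) *s e $ k)"
      by (simp add: vec.scale_sum_right)
    finally have "x - \<rho> {k. odd (c $ k)} \<in> R2" by (intro R2I[OF sum])
    then show ?thesis by blast
  qed
  moreover have "range \<rho> \<subseteq> R" unfolding \<rho>_def using sum by (intro image_subsetI)
  ultimately show ?thesis by (intro exI[of _ "range \<rho>"]) auto
qed

lemma ex_socle: "\<exists>w\<in>R. even_nrm w \<and> w \<notin> R2 \<and> (\<forall>v\<in>R. even_nrm v \<longrightarrow> qmult a b w v \<in> R2)"
proof -
  obtain T where T: "finite T" "T \<subseteq> R" "\<And>x. x \<in> R \<Longrightarrow> \<exists>\<tau>\<in>T. x - \<tau> \<in> R2"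
    using finite_representatives by blast
  \<comment> \<open>The annihilator of \<open>w\<close> modulo 2R, cut down to finitely many
    representatives so that its size can be maximised.\<close>
  define A where "A w = {\<tau> \<in> T. qmult a b w \<tau> \<in> R2}" for w
  define W where "W w \<longleftrightarrow> w \<in> R \<and> even_nrm w \<and> w \<notin> R2" for w
  obtain w0 where "W w0" using ex_even_nrm unfolding W_def by blast
  moreover have "card (A w) \<le> card T" for w unfolding A_def using T(1) by (intro card_mono) auto
  ultimately obtain w where w: "W w" and max: "\<And>w'. W w' \<Longrightarrow> card (A w') \<le> card (A w)"
    using ex_has_greatest_nat[of W w0 "\<lambda>w. card (A w)" "Suc (card T)"] le_imp_less_Suc by blast
  have wR: "w \<in> R" using w by (simp add: W_def)
  have "qmult a b w v \<in> R2" if v: "v \<in> R" "even_nrm v" for v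
  proof (rule ccontr)
    assume nwv: "qmult a b w v \<notin> R2"
    \<comment> \<open>The product is a competitor with a strictly larger annihilator: it keeps that
      of \<open>w\<close> by commutativity modulo 2R, and gains the representative of
      \<open>v\<close> because the square of \<open>v\<close> lies in 2R.\<close>
    then have "W (qmult a b w v)"
      using w v even_nrm_mult mult by (auto simp: W_def)
    obtain \<tau> where \<tau>: "\<tau> \<in> T" "v - \<tau> \<in> R2" using T(3)[OF v(1)] by blast
    have "qmult a b w \<tau> = qmult a b w v - qmult a b w (v - \<tau>)" by (simp add: qmult_diff_right)
    then have "qmult a b w \<tau> \<notin> R2"
      using nwv R2_add[of "qmult a b w \<tau>"] R2_mult(1)[OF wR \<tau>(2)] by (metis diff_add_cancel)
    then have "\<tau> \<notin> A w" by (simp add: A_def)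
    have "qmult a b (qmult a b w v) \<tau> = qmult a b w (qmult a b v v) - qmult a b (qmult a b w v) (v - \<tau>)"
      by (simp add: qmult_diff_right qmult_assoc)
    also have "\<dots> \<in> R2" 
      using R2_diff[OF R2_mult(1)[OF wR even_nrm_square[OF v]] R2_mult(1)[OF mult[OF wR v(1)] \<tau>(2)]] .
    finally have "\<tau> \<in> A (qmult a b w v)" using \<tau> by (simp add: A_def)
    moreover have "A w \<subseteq> A (qmult a b w v)"
    proof
      fix \<sigma> assume "\<sigma> \<in> A w"
      then have \<sigma>: "\<sigma> \<in> T" "\<sigma> \<in> R" "qmult a b w \<sigma> \<in> R2" using T(2) by (auto simp: A_def)
      have "qmult a b (qmult a b w v) \<sigma>
          = qmult a b (qmult a b w \<sigma>) v + qmult a b w (qmult a b v \<sigma> - qmult a b \<sigma> v)"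
        by (simp add: qmult_diff_right qmult_assoc)
      also have "\<dots> \<in> R2" 
        using R2_add[OF R2_mult(2)[OF \<sigma>(3) v(1)] R2_mult(1)[OF wR commutator_R2[OF v(1) \<sigma>(2)]]] .
      finally show "\<sigma> \<in> A (qmult a b w v)" using \<sigma> by (simp add: A_def)
    qed
    ultimately have "A w \<subset> A (qmult a b w v)" using \<open>\<tau> \<notin> A w\<close> by blast
    moreover have "finite (A (qmult a b w v))" using T(1) by (simp add: A_def)
    ultimately have "card (A w) < card (A (qmult a b w v))" by (rule psubset_card_mono[rotated])
    then show False using max[OF \<open>W (qmult a b w v)\<close>] by simp
  qed
  then show ?thesis using w unfolding W_def by blast
qed

text \<open>Otherwise \<open>h\<close>, half of \<open>w\<close>, has integral trace and norm, and
  adjoining it to \<open>R\<close> gives a strictly larger order stable under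
  \<open>ddagger\<close>.\<close>

lemma socle_norm_not_divisible_by_4:
  assumes w: "w \<in> R" "w \<notin> R2" "\<And>v. v \<in> R \<Longrightarrow> even_nrm v \<Longrightarrow> qmult a b w v \<in> R2"
  shows "qnrm a b w \<noteq> 4 * of_int k"
proof
  assume k: "qnrm a b w = 4 * of_int k"
  define h where "h = (1 / 2) *s w"
  have wh: "w = 2 *s h" by (simp add: h_def)
  define S where "S = {x + y | x y. x \<in> R \<and> y \<in> zspan {h}}"
  have S_eq: "S = {x + of_int m *s h | x m. x \<in> R}"
    unfolding S_def zspan_singleton by blast
  have S_diff: "x - y \<in> S" if "x \<in> S" "y \<in> S" for x y
  proof -
    from that obtain x' m y' n where "x' \<in> R" "y' \<in> R" "x = x' + of_int m *s h" "y = y' + of_int n *s h"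
      unfolding S_eq by blast
    then have "x - y = (x' - y') + of_int (m - n) *s h" "x' - y' \<in> R"
      by (simp_all add: vector_sub_rdistrib diff)
    then show ?thesis unfolding S_eq by blast
  qed
  have S_add: "x + y \<in> S" if "x \<in> S" "y \<in> S" for x y
    by (rule subgroup_add[OF S_diff that])
  have S_scale: "of_int m *s x \<in> S" if "x \<in> S" for x m
    by (rule subgroup_scale_int[OF S_diff that])
  have RS: "x \<in> S" if "x \<in> R" for x
  proof -
    have "x = x + of_int 0 *s h" by simp
    then show ?thesis unfolding S_eq using that by blast
  qed
  have hS: "h \<in> S"
  proof -
    have "h = 0 + of_int 1 *s h" by simp
    then show ?thesis unfolding S_eq using zero by blast
  qed
  have half: "x \<in> R" if "2 *s x \<in> R2" for x
  proof -
    obtain y where y: "y \<in> R" "2 *s x = 2 *s y" using \<open>2 *s x \<in> R2\<close> unfolding R2_def by blast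
    then have "x = y" by (simp add: vec_eq_iff)
    then show ?thesis using y by simp
  qed
  \<comment> \<open>For even norm the product is already in \<open>R\<close>; for odd norm
    \<open>x\<close> is replaced by \<open>x - qscalar 1\<close>, at the cost of one
    \<open>h\<close>.\<close>
  have hx: "qmult a b h x \<in> S" if x: "x \<in> R" for x
    using even_nrm_cases[OF x]
  proof
    assume "even_nrm x"
    then have "2 *s qmult a b h x \<in> R2" using w(3)[OF x] by (simp add: wh qmult_scale_left)
    then show ?thesis by (intro RS half)
  next
    assume "even_nrm (x - qscalar 1)"
    then have "2 *s qmult a b h (x - qscalar 1) \<in> R2"
      using w(3)[OF diff[OF x one]] by (simp add: wh qmult_scale_left)
    then have "h + qmult a b h (x - qscalar 1) \<in> S" by (intro S_add hS RS half)
    then show ?thesis by (simp add: qmult_diff_right qmult_one)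
  qed
  have xh: "qmult a b x h \<in> S" if x: "x \<in> R" for x
  proof -
    have "2 *s (qmult a b h x - qmult a b x h) \<in> R2"
      using commutator_R2[OF w(1) x] unfolding wh qmult_scale_left qmult_scale_right
      by (simp add: vec.scale_right_diff_distrib)
    then have "qmult a b h x - (qmult a b h x - qmult a b x h) \<in> S"
      by (intro S_diff hx x RS half)
    then show ?thesis by simp
  qed
  obtain m where m: "w $ 1 = of_int m" using first_integral[OF w(1)] by (elim Ints_cases)
  have "qnrm a b h = of_int k" using k by (simp add: h_def qnrm_def power2_eq_square)
  moreover have "2 * h $ 1 = of_int m" using m by (simp add: h_def)
  ultimately have "qmult a b h h = of_int m *s h - qscalar (of_int k)" using qmult_self[of a b h] by simp
  also have "\<dots> \<in> S" by (intro S_diff S_scale hS RS scalar_int)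
  finally have hh: "qmult a b h h \<in> S" .
  have "S = R"
  proof (rule no_extension[OF _ S_def])
    fix u v assume "u \<in> S" "v \<in> S"
    then obtain x l y n where xy: "x \<in> R" "y \<in> R" "u = x + of_int l *s h" "v = y + of_int n *s h"
      unfolding S_eq by blast
    have "qmult a b u v = qmult a b x y + of_int n *s qmult a b x h
        + (of_int l *s qmult a b h y + of_int (l * n) *s qmult a b h h)"
      unfolding xy qmult_add_left qmult_add_right qmult_scale_left qmult_scale_right
      by (simp add: algebra_simps)
    also have "\<dots> \<in> S" by (intro S_add S_scale RS mult hx xh hh xy)
    finally show "qmult a b u v \<in> S" .
  next
    fix u assume "u \<in> S"
    then obtain x l where x: "x \<in> R" "u = x + of_int l *s h" unfolding S_eq by blast
    \<comment> \<open>\<open>ddagger\<close> changes \<open>h\<close> by \<open>j\<close> times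
      \<open>\<beta>\<close>, which belongs to \<open>R\<close>; an integral fourth coordinate of
      \<open>w\<close> is what makes \<open>j\<close> an integer.\<close>
    obtain j :: int where j: "w $ 4 = of_int j * t" using fourth_integral[OF w(1)] by blast
    have "ddagger h = h - of_int j *s \<beta>"
      using j by (simp add: ddagger_def h_def \<beta>_def vec_eq_iff forall_4)
    then have "ddagger u = ddagger x + of_int l *s (h - of_int j *s \<beta>)"
      using x by (simp add: ddagger_add ddagger_scale)
    also have "\<dots> \<in> S" by (intro S_add S_scale S_diff hS RS ddagger_closed x scale \<beta>_in_order)
    finally show "ddagger u \<in> S" .
  qed simp
  then have "h \<in> R" using hS by simp
  then show False using w(2) wh by (auto intro: R2I)
qed

text \<open>With the norm of \<open>w\<close> equal to 2 modulo 4, the elements of even norm fall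
  into the classes of 0 and \<open>w\<close> modulo 2R, too few for an order of rank 4.\<close>

lemma contradiction: False
proof -
  obtain w where w: "w \<in> R" "even_nrm w" "w \<notin> R2"
    "\<And>v. v \<in> R \<Longrightarrow> even_nrm v \<Longrightarrow> qmult a b w v \<in> R2"
    using ex_socle by blast
  obtain u :: int where u: "qnrm a b w = 2 * of_int u" using w(2) by (auto simp: even_nrm_def)
  have "odd u"
  proof
    assume "even u"
    then obtain k where "u = 2 * k" by blast
    then have "qnrm a b w = 4 * of_int k" using u by simp
    then show False using socle_norm_not_divisible_by_4[OF w(1,3,4)] by blast
  qed
  then obtain v where v: "u = 2 * v + 1" by (blast elim: oddE)
  obtain m where m: "w $ 1 = of_int m" using first_integral[OF w(1)] by (elim Ints_cases)
  have cls: "x \<in> R2 \<or> x - w \<in> R2" if x: "x \<in> R" "even_nrm x" for x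
  proof -
    obtain y where y: "y \<in> R" "qmult a b w x = 2 *s y" using w(4)[OF x] by (auto simp: R2_def)
    \<comment> \<open>Multiplying \<open>w\<close> x = 2y by the conjugate of \<open>w\<close> and
      cancelling 2 gives u x = conj(w) y. As \<open>u\<close> is odd, \<open>x\<close> is congruent
      to - w y modulo 2R, so only the parity of the norm of \<open>y\<close> matters.\<close>
    have "qmult a b (qconj w) (qmult a b w x) = qmult a b (qmult a b (qconj w) w) x"
      by (simp add: qmult_assoc)
    also have "qmult a b (qconj w) w = qscalar (qnrm a b w)"
      by (simp add: qmult_def qconj_def qnrm_def vec_eq_iff forall_4 power2_eq_square algebra_simps)
    also have "qmult a b (qscalar (qnrm a b w)) x = 2 *s (of_int u *s x)"
      by (simp add: u qmult_def vec_eq_iff forall_4)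
    finally have "2 *s qmult a b (qconj w) y = 2 *s (of_int u *s x)"
      by (simp add: y(2) qmult_scale_right)
    then have "of_int u *s x = qmult a b (qconj w) y" by (simp add: vec_eq_iff)
    also have "qconj w = of_int (2 * m) *s qscalar 1 - w"
      by (simp add: qconj_def vec_eq_iff forall_4 m)
    also have "qmult a b (of_int (2 * m) *s qscalar 1 - w) y = of_int (2 * m) *s y - qmult a b w y"
      by (simp add: qmult_diff_left qmult_scale_left qmult_one)
    finally have xu: "of_int u *s x = of_int (2 * m) *s y - qmult a b w y" .
    have x_eq: "x = 2 *s (of_int m *s y - of_int v *s x) - qmult a b w y"
    proof -
      have "x = of_int u *s x - of_int (2 * v) *s x" by (simp add: v vec_eq_iff algebra_simps)
      also have "\<dots> = 2 *s (of_int m *s y - of_int v *s x) - qmult a b w y"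
        unfolding xu by (simp add: vec_eq_iff algebra_simps)
      finally show ?thesis .
    qed
    have s: "2 *s (of_int m *s y - of_int v *s x) \<in> R2"
      by (rule R2I[OF _ refl]) (intro diff scale y x)
    from even_nrm_cases[OF y(1)] show ?thesis
    proof
      assume "even_nrm y"
      then have "x \<in> R2" by (subst x_eq) (intro R2_diff s w(4) y)
      then show ?thesis ..
    next
      assume "even_nrm (y - qscalar 1)"
      \<comment> \<open>For odd norm of \<open>y\<close> the congruence reads x = - w; subtracting
        \<open>2 *s w\<close> corrects the sign.\<close>
      then have "2 *s (of_int m *s y - of_int v *s x) - qmult a b w (y - qscalar 1) - 2 *s w \<in> R2"
        by (intro R2_diff s w(4) diff y one R2I[OF w(1) refl])
      also have "2 *s (of_int m *s y - of_int v *s x) - qmult a b w (y - qscalar 1) - 2 *s w = x - w"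
        by (subst (2) x_eq) (simp add: qmult_diff_right qmult_one vec_eq_iff)
      finally show ?thesis ..
    qed
  qed
  obtain e :: "rat^4^4" where e: "\<And>k. e $ k \<in> R"
    "\<And>c :: int^4. (\<Sum>k\<in>UNIV. of_int (c $ k) *s e $ k) \<in> R2 \<Longrightarrow> \<forall>k. even (c $ k)"
    by (rule basis_mod_2) blast
  \<comment> \<open>Basis vectors are nonzero modulo 2R, which leaves three classes for four of
    them; two congruent ones contradict independence modulo 2.\<close>
  have "\<exists>r\<in>{w, qscalar 1, qscalar 1 + w}. e $ k - r \<in> R2" for k
  proof -
    have "e $ k = (\<Sum>j\<in>UNIV. of_int (axis k 1 $ j) *s e $ j)"
      by (simp add: axis_def if_distrib[of of_int] if_distrib[of "\<lambda>q. q *s _"] cong: if_cong)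
    then have "\<forall>j. even (axis k (1 :: int) $ j)" if "e $ k \<in> R2"
      using e(2)[of "axis k 1"] that by simp
    then have "e $ k \<notin> R2" by (metis axis_nth odd_one)
    then show ?thesis
      using even_nrm_cases[OF e(1)[of k]] cls[OF e(1)[of k]] cls[OF diff[OF e(1)[of k] one]]
      by (auto simp: diff_diff_eq)
  qed
  then obtain r where r: "\<And>k. r k \<in> {w, qscalar 1, qscalar 1 + w}" "\<And>k. e $ k - r k \<in> R2"
    by metis
  have "card (range r) \<le> card {w, qscalar 1, qscalar 1 + w}"
    using r(1) by (intro card_mono) auto
  also have "\<dots> < card (UNIV :: 4 set)" by (simp add: card_insert_if)
  finally have "\<not> inj r" using card_image[of r UNIV] by auto
  then obtain k l where kl: "k \<noteq> l" "r k = r l" by (auto simp: inj_def)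
  have "e $ k - e $ l = (\<Sum>j\<in>UNIV. of_int ((axis k 1 - axis l 1) $ j) *s e $ j)"
    by (simp add: axis_def vector_sub_rdistrib sum_subtractf if_distrib[of of_int] if_distrib[of "\<lambda>q. q *s _"] cong: if_cong)
  moreover have "e $ k - e $ l \<in> R2" using R2_diff[OF r(2)[of k] r(2)[of l]] kl by simp
  ultimately have "\<forall>j. even ((axis k 1 - axis l 1 :: int^4) $ j)" by (intro e(2)) (simp only:)
  then show False using kl(1) by (auto simp: axis_def dest!: spec[of _ k])
qed

end

section \<open>Passing from the fixed lattice to the whole order\<close>

lemma det_4_last_column:
  fixes A :: "'a::comm_ring_1^4^4"
  assumes "A $ 1 $ 4 = 0" "A $ 2 $ 4 = 0" "A $ 3 $ 4 = 0"
  shows "det A = A $ 4 $ 4 *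
    (A$1$1 * A$2$2 * A$3$3 + A$1$2 * A$2$3 * A$3$1 + A$1$3 * A$2$1 * A$3$2
     - A$1$1 * A$2$3 * A$3$2 - A$1$2 * A$2$1 * A$3$3 - A$1$3 * A$2$2 * A$3$1)"
proof -
  have f1234: "finite {2::4, 3, 4}" "1 \<notin> {2::4, 3, 4}" by auto
  have f234: "finite {3::4, 4}" "2 \<notin> {3::4, 4}" by auto
  have f34: "finite {4::4}" "3 \<notin> {4::4}" by auto
  show ?thesis
    unfolding det_def UNIV_4
    unfolding sum_over_permutations_insert[OF f1234]
    unfolding sum_over_permutations_insert[OF f234]
    unfolding sum_over_permutations_insert[OF f34]
    unfolding permutes_sing
    by (simp add: sign_swap_id permutation_swap_id permutation_compose sign_compose sign_id swap_id_eq assms algebra_simps)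
qed

context maximal_ddagger
begin

text \<open>An odd multiple of t/2 can be reduced to t/2 itself by integer multiples of
  \<open>\<beta>\<close>. Absence of t/2 thus makes all fourth coordinates integral multiples of
  \<open>t\<close>, the case refuted above.\<close>

lemma half_\<beta>_coordinate: "\<exists>x\<in>R. 2 * x $ 4 = t"
proof (rule ccontr)
  assume nex: "\<not> (\<exists>x\<in>R. 2 * x $ 4 = t)"
  have "\<exists>k :: int. x $ 4 = of_int k * t" if x: "x \<in> R" for x
  proof -
    obtain k :: int where k: "2 * x $ 4 = of_int k * t" using fourth_coordinate[OF x] .
    show ?thesis
    proof (cases "even k")
      case True
      then obtain j where "k = 2 * j" by blast
      then show ?thesis using k by auto
    next
      case False
      then obtain j where j: "k = 2 * j + 1" by (blast elim: oddE)
      have "x - of_int j *s \<beta> \<in> R" by (rule diff[OF x scale[OF \<beta>_in_order]])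
      moreover have "2 * (x - of_int j *s \<beta>) $ 4 = t"
        using k by (simp add: j \<beta>_def algebra_simps)
      ultimately show ?thesis using nex by blast
    qed
  qed
  then have "integral_fourth_coordinates a b R d t"
    by (intro integral_fourth_coordinates.intro maximal_ddagger_axioms integral_fourth_coordinates_axioms.intro)
  then show False by (rule integral_fourth_coordinates.contradiction)
qed

lemma covolume_embed4_embed3:
  "2 * covolume (embed4 a b ` R) = sqrt (of_int d) * covolume (embed3 a b ` ddagger_fixed R)"
proof -
  have fixed: "x \<in> ddagger_fixed R \<longleftrightarrow> x \<in> R \<and> x $ 4 = 0" for x
    by (auto simp: ddagger_fixed_def ddagger_def vec_eq_iff forall_4)
  obtain z where z: "z \<in> R" "2 * z $ 4 = t" using half_\<beta>_coordinate by blast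
  then have z4: "z $ 4 \<noteq> 0" using d(2) by auto
  obtain f :: "rat^4^3" where f: "is_Zbasis (*s) f (ddagger_fixed R)" "\<And>k. f $ k \<in> ddagger_fixed R"
    using embedded_lattice.Zbasis_ex[OF embedded_lattice_embed3] by blast
  define h where "h c = (\<Sum>k\<in>UNIV. of_int (c $ k) *s f $ k)" for c :: "int^3"
  have bij: "bij_betw h UNIV (ddagger_fixed R)" using f(1) by (simp add: is_Zbasis_def h_def[abs_def])
  have hR: "h c \<in> R" "h c $ 4 = 0" for c
    using bij fixed by (auto simp: bij_betw_def)
  define e :: "rat^4^4" where
    "e = (\<chi> k. if k = 1 then f $ 1 else if k = 2 then f $ 2 else if k = 3 then f $ 3 else z)"
  have e: "e $ 1 = f $ 1" "e $ 2 = f $ 2" "e $ 3 = f $ 3" "e $ 4 = z" by (simp_all add: e_def)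
  define g where "g c = (\<Sum>k\<in>UNIV. of_int (c $ k) *s e $ k)" for c :: "int^4"
  have g: "g c = h (vector [c $ 1, c $ 2, c $ 3]) + of_int (c $ 4) *s z" for c
    by (simp add: g_def h_def sum_3 sum_4 e)
  have "is_Zbasis (*s) e R"
    unfolding is_Zbasis_def g_def[abs_def, symmetric] bij_betw_def
  proof (intro conjI injI subset_antisym subsetI)
    fix c c' assume eq: "g c = g c'"
    then have "g c $ 4 = g c' $ 4" by simp
    then have c4: "c $ 4 = c' $ 4" using z4 by (simp add: g hR(2))
    then have "h (vector [c $ 1, c $ 2, c $ 3]) = h (vector [c' $ 1, c' $ 2, c' $ 3])"
      using eq by (simp add: g)
    then have "(vector [c $ 1, c $ 2, c $ 3] :: int^3) = vector [c' $ 1, c' $ 2, c' $ 3]"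
      using bij by (auto simp: bij_betw_def inj_on_def)
    then show "c = c'" using c4 by (simp add: vec_eq_iff forall_3 forall_4)
  next
    fix x assume "x \<in> range g"
    then show "x \<in> R" by (auto simp: g intro: add hR scale z)
  next
    fix x assume x: "x \<in> R"
    obtain k :: int where k: "2 * x $ 4 = of_int k * t" using fourth_coordinate[OF x] .
    then have "2 * x $ 4 = 2 * (of_int k * z $ 4)" using z(2) by simp
    \<comment> \<open>All fourth coordinates are multiples of that of \<open>z\<close>, so
      subtracting a multiple of \<open>z\<close> leads into the fixed lattice.\<close>
    then have "x - of_int k *s z \<in> ddagger_fixed R"
      unfolding fixed using diff[OF x scale[OF z(1)]] by simp
    then obtain c where c: "x - of_int k *s z = h c" using bij by (auto simp: bij_betw_def)
    have "(vector [c $ 1, c $ 2, c $ 3] :: int^3) = c" by (simp add: vec_eq_iff forall_3)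
    then have "x = g (quat (c $ 1) (c $ 2) (c $ 3) k)"
      unfolding g quat_nth by (simp flip: c)
    then show "x \<in> range g" by blast
  qed
  then have "covolume (embed4 a b ` R) = \<bar>det (\<chi> k. embed4 a b (e $ k))\<bar>"
    by (rule embedded_lattice.covolume_eq[OF embedded_lattice_embed4])
  also have "det (\<chi> k. embed4 a b (e $ k))
      = sqrt (of_rat (a * b)) * of_rat (z $ 4) * det (\<chi> k. embed3 a b (f $ k))"
    using f(2) by (subst det_4_last_column) (simp_all add: fixed e embed4_def embed3_def det_3)
  also have "\<bar>\<dots>\<bar> = sqrt (of_rat (a * b)) * of_rat (z $ 4) * covolume (embed3 a b ` ddagger_fixed R)"
  proof -
    have "z $ 4 > 0" using z(2) d(2) by simp
    then show ?thesis
      using sqrt_pos(3) embedded_lattice.covolume_eq[OF embedded_lattice_embed3 f(1)]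
      by (simp add: abs_mult)
  qed
  finally have "2 * covolume (embed4 a b ` R)
      = sqrt (of_rat (a * b)) * (2 * of_rat (z $ 4)) * covolume (embed3 a b ` ddagger_fixed R)"
    by simp
  also have "2 * of_rat (z $ 4) = (of_rat t :: real)"
    by (simp add: of_rat_mult flip: z(2))
  also have "sqrt (of_rat (a * b)) * of_rat t = sqrt (of_int d)"
  proof -
    have "real_of_int d = of_rat (a * b) * (of_rat t)\<^sup>2"
      using arg_cong[OF d(3), of "of_rat :: rat \<Rightarrow> real"] by (simp add: of_rat_mult of_rat_power)
    then show ?thesis using d(2) by (simp only: real_sqrt_mult) simp
  qed
  finally show ?thesis .
qed

text \<open>The covolume is 2 / sqrt d times that of \<open>R\<close>, and 2 times 1/4 leaves the
  denominator 2.\<close>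

theorem covolume_ddagger_fixed:
  "covolume (embed3 a b ` ddagger_fixed R) = sqrt (real (ideal_abs (quat_disc a b R)))
     / (2 * sqrt (real (ideal_abs (iota (disc_ddagger a b)))))"
proof -
  have "real (ideal_abs (iota (disc_ddagger a b))) = of_int d"
    using ideal_abs_iota[OF d minimal] d(1) by simp
  then show ?thesis
    using covolume_embed4_embed3 covolume_order d(1) by (simp add: field_simps)
qed

end

theorem theorem6p1:
  shows "(\<forall>K. imaginary_quadratic_field K \<longrightarrow>
            covolume (embed2 ` ring_of_integers K)
              = sqrt (real (ideal_abs (quad_disc (ring_of_integers K)))) / 2)
       \<and> (\<forall>a b R. a < 0 \<and> b < 0 \<and> maximal_ddagger_order a b R \<longrightarrow>
            covolume (embed3 a b ` ddagger_fixed R)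
              = sqrt (real (ideal_abs (quat_disc a b R)))
                / (2 * sqrt (real (ideal_abs (iota (disc_ddagger a b))))))
       \<and> (\<forall>a b R. a < 0 \<and> b < 0 \<and> maximal_order a b R \<longrightarrow>
            covolume (embed4 a b ` R)
              = sqrt (real (ideal_abs (quat_disc a b R))) / 4)"
proof (intro conjI allI impI)
  fix K assume "imaginary_quadratic_field K"
  then show "covolume (embed2 ` ring_of_integers K)
      = sqrt (real (ideal_abs (quad_disc (ring_of_integers K)))) / 2"
    by (rule covolume_ring_of_integers)
next
  fix a b R assume asm: "a < 0 \<and> b < 0 \<and> maximal_order a b R"
  then have "quaternion_order a b R" by unfold_locales (auto simp: maximal_order_def)
  then show "covolume (embed4 a b ` R) = sqrt (real (ideal_abs (quat_disc a b R))) / 4"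
    by (rule quaternion_order.covolume_order)
next
  fix a b R assume asm: "a < 0 \<and> b < 0 \<and> maximal_ddagger_order a b R"
  \<comment> \<open>Definiteness makes the square class of ab positive, so a positive
    \<open>d\<close> exists.\<close>
  then have "a * b > 0" by (simp add: mult_neg_neg)
  then obtain d :: int and t :: rat where d: "d > 0" "t > 0" "of_int d = a * b * t\<^sup>2"
    "\<And>s :: rat. of_int d * s\<^sup>2 \<in> \<int> \<Longrightarrow> s \<in> \<int>"
    using minimal_square_class by blast
  have "is_order a b R" using asm by (simp add: maximal_ddagger_order_def ddagger_order_def)
  then have "quaternion_order a b R" using asm by (simp add: quaternion_order_def)
  moreover have "maximal_ddagger_axioms a b R d t"
    using asm d by (intro maximal_ddagger_axioms.intro) blast+
  ultimately have "maximal_ddagger a b R d t" by (rule maximal_ddagger.intro)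
  then show "covolume (embed3 a b ` ddagger_fixed R) = sqrt (real (ideal_abs (quat_disc a b R)))
      / (2 * sqrt (real (ideal_abs (iota (disc_ddagger a b)))))"
    by (rule maximal_ddagger.covolume_ddagger_fixed)
qed

end
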